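(* Let $M^n=\overline M^p\times_f\widetilde M^{n-p}$ be a warped product manifold satisfying $P\cdot R=L_1Q(g,R)$ for some $L_1\in C^\infty(M)$. Then either (i) the base $\overline M$ is flat, or (ii) the fiber $\widetilde M$ is Einstein.
   Context: Setting. $(\overline M,\overline g)$ and $(\widetilde M,\widetilde g)$ are smooth semi-Riemannian manifolds of dimensions $p$ and $n-p$, $1\le p\le n-1$, $n\ge3$; $f$ is a positive smooth function on $\overline M$. The warped product $M=\overline M\times_f\widetilde M$ is the product manifold (assumed connected) with metric $g=\pi^*\overline g+(f\circ\pi)\,\sigma^*\widetilde g$, where $\pi,\sigma$ are the projections to the base $\overline M$ and the fiber $\widetilde M$. $R$ and $S$ are the curvature and Ricci tensors of $g$. Curvature. $\mathcal R(X,Y)Z=\nabla_X\nabla_YZ-\nabla_Y\nabla_XZ-\nabla_{[X,Y]}Z$, $R(X,Y,Z,W)=g(\mathcal R(X,Y)Z,W)$, $S_{jk}=g^{il}R_{ijkl}$. The projective curvature tensor is, with the paper's normalization, $$P(X_1,X_2,X_3,X_4)=R(X_1,X_2,X_3,X_4)-\frac1{n-2}\big[S(X_2,X_3)g(X_1,X_4)-S(X_1,X_3)g(X_2,X_4)\big].$$ Derivation tensors. For a $(0,4)$-tensor $D$ define $\mathcal D(X,Y)$ by $g(\mathcal D(X,Y)X_1,X_2)=D(X,Y,X_1,X_2)$. For a $(0,k)$-tensor $H$ and a symmetric $(0,2)$-tensor $A$, $$(D\cdot H)(X_1,\dots,X_k,X,Y)=-H(\mathcal D(X,Y)X_1,X_2,\dots,X_k)-\cdots-H(X_1,\dots,\mathcal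 D(X,Y)X_k),$$ $$Q(A,H)(X_1,\dots,X_k,X,Y)=\sum_{i=1}^k\big[A(X,X_i)H(X_1,\dots,Y,\dots,X_k)-A(Y,X_i)H(X_1,\dots,X,\dots,X_k)\big],$$ with $Y$ (resp. $X$) in the $i$-th slot. Flat means that the curvature tensor $\overline R$ of $\overline g$ vanishes identically. Einstein means $\widetilde S=\frac{\widetilde\kappa}{n-p}\widetilde g$ on $\widetilde M$, where $\widetilde S,\widetilde\kappa$ are the Ricci tensor and scalar curvature of $\widetilde g$ (no constancy of $\widetilde\kappa$ is required). *)

theory Defs
  imports "HOL-Analysis.Analysis"
begin

section \<open>Smooth maps between open subsets of Euclidean spaces\<close>

(* Intended for open S: all iterated directional derivatives exist and are continuous. *)
primrec Ck_on ::
  "nat \<Rightarrow> 'e::euclidean_space set \<Rightarrow> ('e \<Rightarrow> 'v::real_normed_vector) \<Rightarrow> bool"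
where
  "Ck_on 0 S F \<longleftrightarrow> continuous_on S F"
| "Ck_on (Suc k) S F \<longleftrightarrow>
     (\<forall>x\<in>S. F differentiable (at x)) \<and>
     (\<forall>v. Ck_on k S (\<lambda>x. frechet_derivative F (at x) v))"

definition smooth_on ::
  "'e::euclidean_space set \<Rightarrow> ('e \<Rightarrow> 'v::real_normed_vector) \<Rightarrow> bool"
where
  "smooth_on S F \<longleftrightarrow> (\<forall>k. Ck_on k S F)"


section \<open>Smooth manifolds given by an indexed atlas\<close>

(* The atlas is a family of charts, indexed by the set "charts M"; it need not be maximal.
   The model space is a Euclidean space 'e, so the dimension of the manifold is DIM('e). *)
record ('a, 'i, 'e) manifold =
  mtop   :: "'a topology"
  charts :: "'i set"
  cdom   :: "'i \<Rightarrow> 'a set"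
  cmap   :: "'i \<Rightarrow> 'a \<Rightarrow> 'e"

definition cimg :: "('a, 'i, 'e::euclidean_space) manifold \<Rightarrow> 'i \<Rightarrow> 'e set" where
  "cimg M i = cmap M i ` cdom M i"

definition cinv :: "('a, 'i, 'e::euclidean_space) manifold \<Rightarrow> 'i \<Rightarrow> 'e \<Rightarrow> 'a" where
  "cinv M i = inv_into (cdom M i) (cmap M i)"

definition transition ::
  "('a, 'i, 'e::euclidean_space) manifold \<Rightarrow> 'i \<Rightarrow> 'i \<Rightarrow> 'e \<Rightarrow> 'e" where
  "transition M i j = cmap M j \<circ> cinv M i"

definition smooth_manifold :: "('a, 'i, 'e::euclidean_space) manifold \<Rightarrow> bool" where
  "smooth_manifold M \<longleftrightarrow>
     Hausdorff_space (mtop M) \<and> second_countable (mtop M) \<and>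
     (\<Union>i\<in>charts M. cdom M i) = topspace (mtop M) \<and>
     (\<forall>i\<in>charts M.
        openin (mtop M) (cdom M i) \<and> open (cimg M i) \<and>
        homeomorphic_map (subtopology (mtop M) (cdom M i)) (top_of_set (cimg M i)) (cmap M i)) \<and>
     (\<forall>i\<in>charts M. \<forall>j\<in>charts M.
        smooth_on (cmap M i ` (cdom M i \<inter> cdom M j)) (transition M i j))"

definition smooth_function ::
  "('a, 'i, 'e::euclidean_space) manifold \<Rightarrow> ('a \<Rightarrow> real) \<Rightarrow> bool" where
  "smooth_function M F \<longleftrightarrow> (\<forall>i\<in>charts M. smooth_on (cimg M i) (F \<circ> cinv M i))"


section \<open>Semi-Riemannian metrics\<close>

(* A tangent vector at x is represented in the chart i by an element of 'e, with the Jacobian of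
   the transition map as change of coordinates.  A metric g is accordingly represented by its
   local expressions: g i x is the bilinear form on 'e expressing the metric at x in the chart i.
   The local expressions are required to be compatible on overlaps.
   No condition on the index is needed: by nondegeneracy and continuity it is locally constant,
   hence constant when the manifold is connected. *)
definition semi_riemannian_metric ::
  "('a, 'i, 'e::euclidean_space) manifold \<Rightarrow> ('i \<Rightarrow> 'a \<Rightarrow> 'e \<Rightarrow> 'e \<Rightarrow> real) \<Rightarrow> bool" where
  "semi_riemannian_metric M g \<longleftrightarrow>
     (\<forall>i\<in>charts M. \<forall>x\<in>cdom M i.
        bilinear (g i x) \<and>
        (\<forall>u v. g i x u v = g i x v u) \<and>
        (\<forall>u. (\<forall>v. g i x u v = 0) \<longrightarrow> u = 0)) \<and>
     (\<forall>i\<in>charts M. \<forall>u v. smooth_on (cimg M i) (\<lambda>y. g i (cinv M i y) u v)) \<and>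
     (\<forall>i\<in>charts M. \<forall>j\<in>charts M. \<forall>x\<in>cdom M i \<inter> cdom M j. \<forall>u v.
        g i x u v =
        g j x (frechet_derivative (transition M i j) (at (cmap M i x)) u)
              (frechet_derivative (transition M i j) (at (cmap M i x)) v))"

definition semi_riemannian_manifold ::
  "('a, 'i, 'e::euclidean_space) manifold \<Rightarrow> ('i \<Rightarrow> 'a \<Rightarrow> 'e \<Rightarrow> 'e \<Rightarrow> real) \<Rightarrow> bool" where
  "semi_riemannian_manifold M g \<longleftrightarrow> smooth_manifold M \<and> semi_riemannian_metric M g"


section \<open>Multilinear algebra of a nondegenerate symmetric bilinear form\<close>

(* The vector v with b(v,w) = l(w) for all w. *)
definition raise :: "('e::euclidean_space \<Rightarrow> 'e \<Rightarrow> real) \<Rightarrow> ('e \<Rightarrow> real) \<Rightarrow> 'e" where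
  "raise b l = (THE v. \<forall>w. b v w = l w)"

(* For basis vectors a, c this is the entry b^{ac} of the inverse matrix: the sharp of the
   coordinate form dual to a, evaluated on the coordinate form dual to c. *)
definition inverse_metric :: "('e::euclidean_space \<Rightarrow> 'e \<Rightarrow> real) \<Rightarrow> 'e \<Rightarrow> 'e \<Rightarrow> real" where
  "inverse_metric b a c = raise b (\<lambda>w. a \<bullet> w) \<bullet> c"

definition contraction ::
  "('e::euclidean_space \<Rightarrow> 'e \<Rightarrow> real) \<Rightarrow> ('e \<Rightarrow> 'e \<Rightarrow> real) \<Rightarrow> real" where
  "contraction b T = (\<Sum>a\<in>Basis. \<Sum>c\<in>Basis. inverse_metric b a c * T a c)"

type_synonym 'e tensor2 = "'e \<Rightarrow> 'e \<Rightarrow> real"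
type_synonym 'e tensor4 = "'e \<Rightarrow> 'e \<Rightarrow> 'e \<Rightarrow> 'e \<Rightarrow> real"

(* A (0,k)-tensor is a function of lists of length k. *)
definition of_tensor4 :: "'e tensor4 \<Rightarrow> 'e list \<Rightarrow> real" where
  "of_tensor4 T xs = T (xs ! 0) (xs ! 1) (xs ! 2) (xs ! 3)"

definition tensor_endo ::
  "'e::euclidean_space tensor2 \<Rightarrow> 'e tensor4 \<Rightarrow> 'e \<Rightarrow> 'e \<Rightarrow> 'e \<Rightarrow> 'e" where
  "tensor_endo b D X Y Z = raise b (\<lambda>w. D X Y Z w)"

(* D . H *)
definition derivation_action ::
  "'e::euclidean_space tensor2 \<Rightarrow> 'e tensor4 \<Rightarrow> ('e list \<Rightarrow> real) \<Rightarrow> 'e list \<Rightarrow> 'e \<Rightarrow> 'e \<Rightarrow> real"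
where
  "derivation_action b D H xs X Y =
     - (\<Sum>i<length xs. H (xs[i := tensor_endo b D X Y (xs ! i)]))"

(* Q(A,H) *)
definition tachibana ::
  "'e::euclidean_space tensor2 \<Rightarrow> ('e list \<Rightarrow> real) \<Rightarrow> 'e list \<Rightarrow> 'e \<Rightarrow> 'e \<Rightarrow> real"
where
  "tachibana A H xs X Y =
     (\<Sum>i<length xs. A X (xs ! i) * H (xs[i := Y]) - A Y (xs ! i) * H (xs[i := X]))"


section \<open>Local semi-Riemannian geometry on an open subset of a Euclidean space\<close>

(* Here G y is the value at y of a metric on an open set, and vector fields are maps 'e => 'e.
   Only germs at the point of evaluation matter. *)

definition lie_bracket ::
  "('e::euclidean_space \<Rightarrow> 'e) \<Rightarrow> ('e \<Rightarrow> 'e) \<Rightarrow> 'e \<Rightarrow> 'e" where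
  "lie_bracket X Y y =
     frechet_derivative Y (at y) (X y) - frechet_derivative X (at y) (Y y)"

(* The Levi-Civita connection, by Koszul's formula
     2 G(nabla_X Y, W) = X G(Y,W) + Y G(X,W) - W G(X,Y)
                         + G([X,Y],W) - G([X,W],Y) - G([Y,W],X),
   tested against the coordinate (constant) fields W = w. *)
definition nabla ::
  "('e::euclidean_space \<Rightarrow> 'e \<Rightarrow> 'e \<Rightarrow> real) \<Rightarrow> ('e \<Rightarrow> 'e) \<Rightarrow> ('e \<Rightarrow> 'e) \<Rightarrow> 'e \<Rightarrow> 'e" where
  "nabla G X Y y = raise (G y) (\<lambda>w.
     (frechet_derivative (\<lambda>z. G z (Y z) w) (at y) (X y)
      + frechet_derivative (\<lambda>z. G z (X z) w) (at y) (Y y)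
      - frechet_derivative (\<lambda>z. G z (X z) (Y z)) (at y) w
      + G y (lie_bracket X Y y) w
      - G y (lie_bracket X (\<lambda>_. w) y) (Y y)
      - G y (lie_bracket Y (\<lambda>_. w) y) (X y)) / 2)"

definition curvature_operator ::
  "('e::euclidean_space \<Rightarrow> 'e \<Rightarrow> 'e \<Rightarrow> real) \<Rightarrow>
   ('e \<Rightarrow> 'e) \<Rightarrow> ('e \<Rightarrow> 'e) \<Rightarrow> ('e \<Rightarrow> 'e) \<Rightarrow> 'e \<Rightarrow> 'e"
where
  "curvature_operator G X Y Z y =
     nabla G X (nabla G Y Z) y - nabla G Y (nabla G X Z) y - nabla G (lie_bracket X Y) Z y"

(* The value at y on tangent vectors, which are extended to coordinate (constant) fields; the
   curvature operator is tensorial, so the choice of extension is immaterial. *)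
definition local_riemann ::
  "('e::euclidean_space \<Rightarrow> 'e \<Rightarrow> 'e \<Rightarrow> real) \<Rightarrow> 'e \<Rightarrow> 'e tensor4" where
  "local_riemann G y u v w z =
     G y (curvature_operator G (\<lambda>_. u) (\<lambda>_. v) (\<lambda>_. w) y) z"


section \<open>Curvature tensors of a semi-Riemannian manifold\<close>

(* All tensors are given by their local expressions: the value at x in the chart i. *)

definition riemann ::
  "('a, 'i, 'e::euclidean_space) manifold \<Rightarrow> ('i \<Rightarrow> 'a \<Rightarrow> 'e \<Rightarrow> 'e \<Rightarrow> real) \<Rightarrow>
   'i \<Rightarrow> 'a \<Rightarrow> 'e tensor4"
where
  "riemann M g i x = local_riemann (\<lambda>y. g i (cinv M i y)) (cmap M i x)"

(* S_{jk} = g^{il} R_{ijkl} *)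
definition ricci ::
  "('a, 'i, 'e::euclidean_space) manifold \<Rightarrow> ('i \<Rightarrow> 'a \<Rightarrow> 'e \<Rightarrow> 'e \<Rightarrow> real) \<Rightarrow>
   'i \<Rightarrow> 'a \<Rightarrow> 'e tensor2"
where
  "ricci M g i x u v = contraction (g i x) (\<lambda>a c. riemann M g i x a u v c)"

definition scalar_curvature ::
  "('a, 'i, 'e::euclidean_space) manifold \<Rightarrow> ('i \<Rightarrow> 'a \<Rightarrow> 'e \<Rightarrow> 'e \<Rightarrow> real) \<Rightarrow>
   'i \<Rightarrow> 'a \<Rightarrow> real"
where
  "scalar_curvature M g i x = contraction (g i x) (ricci M g i x)"

(* Normalized by 1/(n-2), not by the more common 1/(n-1), where n is the dimension. *)
definition projective ::
  "('a, 'i, 'e::euclidean_space) manifold \<Rightarrow> ('i \<Rightarrow> 'a \<Rightarrow> 'e \<Rightarrow> 'e \<Rightarrow> real) \<Rightarrow>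
   'i \<Rightarrow> 'a \<Rightarrow> 'e tensor4"
where
  "projective M g i x u1 u2 u3 u4 =
     riemann M g i x u1 u2 u3 u4
     - 1 / (real DIM('e) - 2) *
       (ricci M g i x u2 u3 * g i x u1 u4 - ricci M g i x u1 u3 * g i x u2 u4)"

definition flat ::
  "('a, 'i, 'e::euclidean_space) manifold \<Rightarrow> ('i \<Rightarrow> 'a \<Rightarrow> 'e \<Rightarrow> 'e \<Rightarrow> real) \<Rightarrow> bool"
where
  "flat M g \<longleftrightarrow>
     (\<forall>i\<in>charts M. \<forall>x\<in>cdom M i. \<forall>u v w z. riemann M g i x u v w z = 0)"

definition einstein ::
  "('a, 'i, 'e::euclidean_space) manifold \<Rightarrow> ('i \<Rightarrow> 'a \<Rightarrow> 'e \<Rightarrow> 'e \<Rightarrow> real) \<Rightarrow> bool"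
where
  "einstein M g \<longleftrightarrow>
     (\<forall>i\<in>charts M. \<forall>x\<in>cdom M i. \<forall>u v.
        ricci M g i x u v = scalar_curvature M g i x / real DIM('e) * g i x u v)"


section \<open>Warped products\<close>

definition product_manifold ::
  "('a, 'i, 'e::euclidean_space) manifold \<Rightarrow> ('b, 'j, 'f::euclidean_space) manifold \<Rightarrow>
   ('a \<times> 'b, 'i \<times> 'j, 'e \<times> 'f) manifold"
where
  "product_manifold M N =
     \<lparr> mtop = prod_topology (mtop M) (mtop N),
       charts = charts M \<times> charts N,
       cdom = (\<lambda>(i, j). cdom M i \<times> cdom N j),
       cmap = (\<lambda>(i, j). map_prod (cmap M i) (cmap N j)) \<rparr>"

(* In product charts the differentials of the two projections are fst and snd, so this is
   pi^* g + (f o pi) sigma^* h.  The warping function enters as f, not as its square. *)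
definition warped_metric ::
  "('a \<Rightarrow> real) \<Rightarrow> ('i \<Rightarrow> 'a \<Rightarrow> 'e \<Rightarrow> 'e \<Rightarrow> real) \<Rightarrow>
   ('j \<Rightarrow> 'b \<Rightarrow> 'f \<Rightarrow> 'f \<Rightarrow> real) \<Rightarrow>
   'i \<times> 'j \<Rightarrow> 'a \<times> 'b \<Rightarrow> 'e \<times> 'f \<Rightarrow> 'e \<times> 'f \<Rightarrow> real"
where
  "warped_metric f g h c m U V =
     g (fst c) (fst m) (fst U) (fst V) + f (fst m) * h (snd c) (snd m) (snd U) (snd V)"

end

theory Submission
  imports Defs
begin

text \<open>
  The projective endomorphism is \<open>P(X,Y)Z = R(X,Y)Z - k (S(Y,Z) X - S(X,Z) Y)\<close> with \<open>k = 1/(n-2)\<close>, so the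
  hypothesis reads \<open>R \<cdot> R - k Q(S,R) = L1 Q(g,R)\<close>. It is evaluated on three base vectors \<open>a, b, c\<close> and one
  fiber vector \<open>\<alpha>\<close> in the slots of \<open>R\<close>, with \<open>X = d\<close> in the base and \<open>Y = \<beta>\<close> in the fiber.

  In a warped product, a curvature component with two base and two fiber arguments is a function of the
  base arguments times the fiber metric \<open>h\<close> of the fiber arguments, and a component with exactly one fiber
  argument vanishes. Therefore all terms of \<open>R \<cdot> R\<close> and of \<open>Q(g,R)\<close>, and all but one term of \<open>Q(S,R)\<close>, are
  multiples of \<open>h(\<beta>,\<alpha>)\<close>, with coefficients independent of \<open>\<alpha>\<close> and \<open>\<beta>\<close>. The remaining term is
  \<open>k S(\<beta>,\<alpha>) R(a,b,c,d)\<close>, and \<open>R(a,b,c,d)\<close> is a component of the curvature of the base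
  (\<open>fiber_block_proportional\<close>). If it is nonzero at some point \<open>x\<close> of the base, then over every point \<open>y\<close> of
  the fiber the restriction of \<open>S\<close> to the fiber directions at \<open>(x,y)\<close> is a multiple of \<open>h\<close>. That restriction
  differs from the Ricci tensor of the fiber by a multiple of \<open>h\<close> (\<open>ricci_fiber\<close>), so the fiber is Einstein at
  \<open>y\<close>.

  Most of the work is the curvature of a warped product in a product chart. It is read off from the
  Christoffel symbols (\<open>christoffel_warped\<close>), whose differentiability rests on the fact that the solution of a
  linear system with differentiable coefficients is differentiable (\<open>differentiable_linear_solution\<close>).
\<close>


section \<open>Nondegenerate symmetric bilinear forms\<close>

locale nondegenerate_form =
  fixes b :: "'e::euclidean_space \<Rightarrow> 'e \<Rightarrow> real"
  assumes bil: "bilinear b"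
    and sym: "b u v = b v u"
    and nondeg: "(\<And>v. b u v = 0) \<Longrightarrow> u = 0"
begin

lemma raise_eqI:
  assumes "\<And>w. b v w = l w"
  shows "raise b l = v"
  unfolding raise_def
proof (rule the_equality)
  fix v' assume v': "\<forall>w. b v' w = l w"
  have "b (v' - v) w = 0" for w
    using v' assms by (simp add: bilinear_lsub[OF bil])
  then have "v' - v = 0" by (rule nondeg)
  then show "v' = v" by simp
qed (use assms in blast)

lemma raise_form [simp]: "raise b (b v) = v"
  by (rule raise_eqI) simp

lemma eqI:
  assumes "\<And>w. b u w = b v w"
  shows "u = v"
  using raise_eqI[of u "b v"] assms by simp

text \<open>The operator that represents \<open>b\<close> with respect to the inner product of the model space. It turns
  the defining property of \<^const>\<open>raise\<close> into a linear equation between vectors.\<close>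
definition gram_operator :: "'e \<Rightarrow> 'e" where
  "gram_operator v = (\<Sum>e\<in>Basis. b v e *\<^sub>R e)"

lemma linear_gram_operator: "linear gram_operator"
  unfolding gram_operator_def
  by (rule linearI)
    (simp_all add: bilinear_ladd[OF bil] bilinear_lmul[OF bil] scaleR_add_left sum.distrib
      scaleR_sum_right)

lemma gram_operator_inner: "gram_operator v \<bullet> w = b v w"
proof -
  interpret linear "b v" using bil by (simp add: bilinear_def)
  have "b v w = b v (\<Sum>e\<in>Basis. (w \<bullet> e) *\<^sub>R e)" by (simp add: euclidean_representation)
  also have "\<dots> = gram_operator v \<bullet> w"
    by (simp add: sum scale gram_operator_def inner_sum_left inner_commute[of w] mult.commute)
  finally show ?thesis by simp
qed

lemma inj_gram_operator: "inj gram_operator"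
  by (rule injI, rule eqI) (metis gram_operator_inner)

text \<open>The linear form \<open>l\<close> is represented by some vector under the inner product, and the Gram operator,
  being injective on a finite-dimensional space, hits that vector.\<close>
lemma raise_works:
  assumes "linear l"
  shows "b (raise b l) w = l w"
proof -
  interpret linear l by fact
  have "surj gram_operator"
    using linear_gram_operator inj_gram_operator by (rule linear_inj_imp_surj)
  then obtain v where v: "gram_operator v = (\<Sum>e\<in>Basis. l e *\<^sub>R e)" by (metis surjD)
  have "b v w = l w" for w
  proof -
    have "b v w = (\<Sum>e\<in>Basis. l e *\<^sub>R e) \<bullet> w" by (metis v gram_operator_inner)
    also have "\<dots> = l (\<Sum>e\<in>Basis. (w \<bullet> e) *\<^sub>R e)"
      by (simp add: sum scale inner_sum_left inner_commute[of w] mult.commute)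
    finally show ?thesis by (simp add: euclidean_representation)
  qed
  then show ?thesis by (simp add: raise_eqI[of v l])
qed

text \<open>With the first index of \<open>T\<close> lowered from \<open>L\<close>, the inverse matrix of \<open>b\<close> cancels \<open>b\<close>. For a linear \<open>L\<close>
  the right-hand side is its trace, so the Ricci tensor becomes an honest trace of the curvature operator,
  computed in the standard basis and without reference to the metric.\<close>
lemma contraction_eq_trace:
  "contraction b (\<lambda>a c. b (L a) c) = (\<Sum>a\<in>Basis. L a \<bullet> a)"
proof -
  have "(\<Sum>c\<in>Basis. inverse_metric b a c * b (L a) c) = L a \<bullet> a" for a
  proof -
    define r where "r = raise b (\<lambda>w. a \<bullet> w)"
    have "linear (\<lambda>w. a \<bullet> w)"
      by (simp add: bounded_linear.linear bounded_linear_inner_right)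
    then have "L a \<bullet> a = b r (L a)"
      by (simp add: r_def raise_works inner_commute)
    also have "\<dots> = gram_operator (L a) \<bullet> r"
      by (simp add: gram_operator_inner sym)
    also have "\<dots> = (\<Sum>c\<in>Basis. inverse_metric b a c * b (L a) c)"
      by (simp add: gram_operator_def inverse_metric_def r_def[symmetric] inner_sum_left mult.commute
          inner_commute[of r])
    finally show ?thesis by simp
  qed
  then show ?thesis by (simp add: contraction_def)
qed

end


section \<open>Solutions of linear equations depending differentiably on a parameter\<close>

text \<open>The product rule in the borderline case of a factor \<open>c\<close> that is merely continuous: it suffices that the
  other factor vanishes at the point, because then the increments of \<open>c\<close> are multiplied by terms of first
  order.\<close>
lemma has_derivative_scaleR_vanishing:
  fixes F :: "'e::euclidean_space \<Rightarrow> 'v::real_normed_vector"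
  assumes c: "isCont c z" and F: "(F has_derivative F') (at z)" and F0: "F z = 0"
  shows "((\<lambda>y. c y *\<^sub>R F y) has_derivative (\<lambda>h. c z *\<^sub>R F' h)) (at z)"
proof -
  have blF: "bounded_linear F'" using F by (rule has_derivative_bounded_linear)
  obtain K where K: "\<And>h. norm (F' h) \<le> norm h * K"
    using bounded_linear.bounded[OF blF] by blast
  have r: "((\<lambda>y. norm (F y - F' (y - z)) / norm (y - z)) \<longlongrightarrow> 0) (at z)"
    using F F0 by (simp add: has_derivative_iff_norm)
  have ct: "(c \<longlongrightarrow> c z) (at z)" using c by (simp add: isCont_def)
  have lim: "((\<lambda>y. \<bar>c y\<bar> * (norm (F y - F' (y - z)) / norm (y - z)) + \<bar>c y - c z\<bar> * K)
      \<longlongrightarrow> \<bar>c z\<bar> * 0 + \<bar>c z - c z\<bar> * K) (at z)"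
    by (intro tendsto_intros r ct)
  have "((\<lambda>y. norm (c y *\<^sub>R F y - c z *\<^sub>R F' (y - z)) / norm (y - z)) \<longlongrightarrow> 0) (at z)"
  proof (rule tendsto_sandwich[OF _ _ tendsto_const])
    show "\<forall>\<^sub>F y in at z. 0 \<le> norm (c y *\<^sub>R F y - c z *\<^sub>R F' (y - z)) / norm (y - z)"
      by simp
    show "((\<lambda>y. \<bar>c y\<bar> * (norm (F y - F' (y - z)) / norm (y - z)) + \<bar>c y - c z\<bar> * K) \<longlongrightarrow> 0) (at z)"
      using lim by simp
    show "\<forall>\<^sub>F y in at z. norm (c y *\<^sub>R F y - c z *\<^sub>R F' (y - z)) / norm (y - z) \<le>
        \<bar>c y\<bar> * (norm (F y - F' (y - z)) / norm (y - z)) + \<bar>c y - c z\<bar> * K"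
      unfolding eventually_at_filter
    proof (intro always_eventually allI impI)
      fix y assume "y \<noteq> z"
      then have p: "norm (y - z) > 0" by simp
      have "c y *\<^sub>R F y - c z *\<^sub>R F' (y - z)
          = c y *\<^sub>R (F y - F' (y - z)) + (c y - c z) *\<^sub>R F' (y - z)"
        by (simp add: algebra_simps)
      also have "norm \<dots> \<le> \<bar>c y\<bar> * norm (F y - F' (y - z)) + \<bar>c y - c z\<bar> * (norm (y - z) * K)"
        by (rule order_trans[OF norm_triangle_ineq]) (simp add: add_mono mult_left_mono K)
      finally show "norm (c y *\<^sub>R F y - c z *\<^sub>R F' (y - z)) / norm (y - z) \<le>
        \<bar>c y\<bar> * (norm (F y - F' (y - z)) / norm (y - z)) + \<bar>c y - c z\<bar> * K"
        using p by (simp add: field_simps)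
    qed
  qed
  then show ?thesis
    using F0 bounded_linear_scaleR_right[THEN bounded_linear_compose, OF blF]
    by (simp add: has_derivative_iff_norm)
qed

lemma linear_expand:
  fixes A :: "'e::euclidean_space \<Rightarrow> 'v::real_vector"
  assumes "linear A"
  shows "A u = (\<Sum>e\<in>Basis. (u \<bullet> e) *\<^sub>R A e)"
proof -
  interpret linear A by fact
  have "A u = A (\<Sum>e\<in>Basis. (u \<bullet> e) *\<^sub>R e)" by (simp add: euclidean_representation)
  then show ?thesis by (simp add: sum scale)
qed

text \<open>Raising an index solves a linear system whose matrix and right-hand side depend on the point; the
  Christoffel symbols arise in this way. Subtracting the systems at \<open>y\<close> and \<open>z\<close> gives
  \<open>A z (v y - v z) = l y - l z - (A y - A z) (v y)\<close>. First this yields continuity of \<open>v\<close>, since \<open>A z\<close> is bounded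
  below and \<open>A y - A z\<close> tends to \<open>0\<close>; then \<open>(A y - A z) (v y)\<close> is a sum of products of a continuous function
  and a differentiable one vanishing at \<open>z\<close>, hence differentiable, and applying a left inverse of \<open>A z\<close> gives
  the claim.\<close>
lemma differentiable_linear_solution:
  fixes A :: "'x::euclidean_space \<Rightarrow> 'e::euclidean_space \<Rightarrow> 'v::euclidean_space"
  assumes S: "open S" "z \<in> S"
    and lin: "\<And>y. y \<in> S \<Longrightarrow> linear (A y)"
    and inj: "inj (A z)"
    and A: "\<And>u. (\<lambda>y. A y u) differentiable (at z)"
    and l: "l differentiable (at z)"
    and eq: "\<And>y. y \<in> S \<Longrightarrow> A y (v y) = l y"
  shows "v differentiable (at z)"
proof -
  have linz: "linear (A z)" using S lin by blast
  obtain B where B: "B > 0" "\<And>u. B * norm u \<le> norm (A z u)"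
    using linear_inj_bounded_below_pos[OF linz inj] by blast
  obtain A' where A': "linear A'" "A' \<circ> A z = id"
    using linear_injective_left_inverse[OF linz inj] by blast
  define E where "E y = (\<Sum>e\<in>Basis. norm (A y e - A z e))" for y
  have Sev: "\<forall>\<^sub>F y in at z. y \<in> S" using S by (metis eventually_at_topological)
  have E0: "(E \<longlongrightarrow> 0) (at z)"
  proof -
    have "((\<lambda>y. A y e) \<longlongrightarrow> A z e) (at z)" for e
      using differentiable_imp_continuous_within[OF A[of e]] by (simp add: continuous_within)
    then have "(E \<longlongrightarrow> (\<Sum>e\<in>Basis. norm (A z e - A z e))) (at z)"
      unfolding E_def by (intro tendsto_intros)
    then show ?thesis by simp
  qed
  have l0: "(l \<longlongrightarrow> l z) (at z)"
    using differentiable_imp_continuous_within[OF l] by (simp add: continuous_within)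
  have diffA: "A y u - A z u = (\<Sum>e\<in>Basis. (u \<bullet> e) *\<^sub>R (A y e - A z e))" if "y \<in> S" for y u
    using linear_expand[OF lin[OF that], of u] linear_expand[OF linz, of u]
    by (simp add: scaleR_diff_right sum_subtractf)
  have AE: "norm (A y u - A z u) \<le> E y * norm u" if "y \<in> S" for y u
    unfolding diffA[OF that, of u] E_def sum_distrib_right
  proof (rule sum_norm_le)
    fix e :: 'e assume "e \<in> Basis"
    then have "\<bar>u \<bullet> e\<bar> * norm (A y e - A z e) \<le> norm u * norm (A y e - A z e)"
      by (intro mult_right_mono Basis_le_norm) auto
    then show "norm ((u \<bullet> e) *\<^sub>R (A y e - A z e)) \<le> norm (A y e - A z e) * norm u"
      by (simp add: mult.commute)
  qed
  have key: "A z (v y - v z) = l y - l z - (A y (v y) - A z (v y))" if "y \<in> S" for y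
    using eq[OF that] eq[OF S(2)] linear_diff[OF linz] by simp
  \<comment> \<open>Near \<open>z\<close> the equation still bounds \<open>v\<close>, with half the lower bound of \<open>A z\<close>.\<close>
  have bnd: "\<forall>\<^sub>F y in at z. norm (v y) \<le> 2 / B * norm (l y)"
  proof -
    have "\<forall>\<^sub>F y in at z. E y < B / 2" using E0 B(1) by (intro order_tendstoD) auto
    then show ?thesis using Sev
    proof eventually_elim
      case (elim y)
      have "B * norm (v y) \<le> norm (A z (v y))" by (rule B)
      also have "\<dots> \<le> norm (A y (v y)) + norm (A y (v y) - A z (v y))"
        by (metis norm_triangle_sub norm_minus_commute add.commute)
      also have "\<dots> \<le> norm (l y) + B / 2 * norm (v y)"
        using AE[OF elim(2), of "v y"] elim eq mult_right_mono[of "E y" "B/2" "norm (v y)"] by simp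
      finally show ?case using B(1) by (simp add: field_simps)
    qed
  qed
  have vcont: "(v \<longlongrightarrow> v z) (at z)"
  proof -
    have "((\<lambda>y. norm (v y - v z)) \<longlongrightarrow> 0) (at z)"
    proof (rule tendsto_sandwich[OF _ _ tendsto_const])
      show "((\<lambda>y. (norm (l y - l z) + E y * (2 / B * norm (l y))) / B) \<longlongrightarrow> 0) (at z)"
      proof -
        have "((\<lambda>y. (norm (l y - l z) + E y * (2 / B * norm (l y))) / B) \<longlongrightarrow>
          (norm (l z - l z) + 0 * (2 / B * norm (l z))) / B) (at z)"
          using B(1) by (intro tendsto_intros E0 l0) auto
        then show ?thesis by simp
      qed
      show "\<forall>\<^sub>F y in at z. norm (v y - v z) \<le> (norm (l y - l z) + E y * (2 / B * norm (l y))) / B"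
        using Sev bnd
      proof eventually_elim
        case (elim y)
        have "E y \<ge> 0" by (simp add: E_def sum_nonneg)
        have "B * norm (v y - v z) \<le> norm (A z (v y - v z))" by (rule B)
        also have "\<dots> \<le> norm (l y - l z) + norm (A y (v y) - A z (v y))"
          unfolding key[OF elim(1)] by (rule norm_triangle_ineq4)
        also have "\<dots> \<le> norm (l y - l z) + E y * (2 / B * norm (l y))"
          using AE[OF elim(1), of "v y"] mult_left_mono[OF elim(2) \<open>E y \<ge> 0\<close>] by simp
        finally show ?case using B(1) by (simp add: field_simps)
      qed
    qed simp
    then show ?thesis by (simp add: tendsto_norm_zero_iff LIM_zero_iff)
  qed
  have vform: "v y = v z + A' (l y - l z - (\<Sum>e\<in>Basis. (v y \<bullet> e) *\<^sub>R (A y e - A z e)))"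
    if "y \<in> S" for y
  proof -
    have "A' (A z (v y - v z)) = v y - v z" using A'(2) by (metis comp_apply id_apply)
    then show ?thesis unfolding key[OF that] diffA[OF that, of "v y"] by (simp add: algebra_simps)
  qed
  have "(\<lambda>y. (v y \<bullet> e) *\<^sub>R (A y e - A z e)) differentiable (at z)" for e
  proof -
    have "isCont (\<lambda>y. v y \<bullet> e) z"
      unfolding isCont_def by (intro tendsto_intros vcont)
    moreover obtain F' where "((\<lambda>y. A y e - A z e) has_derivative F') (at z)"
      using differentiable_diff[OF A[of e] differentiable_const[of "A z e"]] unfolding differentiable_def by blast
    ultimately have "((\<lambda>y. (v y \<bullet> e) *\<^sub>R (A y e - A z e)) has_derivative (\<lambda>h. (v z \<bullet> e) *\<^sub>R F' h)) (at z)"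
      by (rule has_derivative_scaleR_vanishing) simp
    then show ?thesis by (rule differentiableI)
  qed
  then have "(\<lambda>y. l y - l z - (\<Sum>e\<in>Basis. (v y \<bullet> e) *\<^sub>R (A y e - A z e))) differentiable (at z)"
    by (intro differentiable_diff differentiable_sum l differentiable_const) auto
  then obtain D where D: "((\<lambda>y. l y - l z - (\<Sum>e\<in>Basis. (v y \<bullet> e) *\<^sub>R (A y e - A z e))) has_derivative D) (at z)"
    unfolding differentiable_def by blast
  have "bounded_linear A'" using A'(1) by (simp add: linear_conv_bounded_linear)
  then have "((\<lambda>y. v z + A' (l y - l z - (\<Sum>e\<in>Basis. (v y \<bullet> e) *\<^sub>R (A y e - A z e))))
      has_derivative (\<lambda>h. 0 + A' (D h))) (at z)"
    by (intro has_derivative_add has_derivative_const bounded_linear.has_derivative[OF _ D])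
  then have "(v has_derivative (\<lambda>h. 0 + A' (D h))) (at z)"
    by (rule has_derivative_transform_within_open[OF _ S(1) S(2)]) (simp add: vform[symmetric])
  then show ?thesis unfolding differentiable_def by blast
qed


section \<open>The Levi-Civita connection in a chart\<close>

abbreviation dir_deriv :: "('e::euclidean_space \<Rightarrow> 'v::real_normed_vector) \<Rightarrow> 'e \<Rightarrow> 'e \<Rightarrow> 'v" where
  "dir_deriv F z u \<equiv> frechet_derivative F (at z) u"

lemma dir_deriv_eq: "(F has_derivative F') (at z) \<Longrightarrow> dir_deriv F z u = F' u"
  using frechet_derivative_at by metis

lemma differentiable_transform_open:
  assumes "F differentiable (at z)" "open S" "z \<in> S" "\<And>y. y \<in> S \<Longrightarrow> F y = F' y"
  shows "F' differentiable (at z)"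
  using assms has_derivative_transform_within_open unfolding differentiable_def by metis

definition metric_deriv ::
  "('e::euclidean_space \<Rightarrow> 'e \<Rightarrow> 'e \<Rightarrow> real) \<Rightarrow> 'e \<Rightarrow> 'e \<Rightarrow> 'e \<Rightarrow> 'e \<Rightarrow> real" where
  "metric_deriv G z a u v = dir_deriv (\<lambda>y. G y u v) z a"

text \<open>Koszul's formula for coordinate fields, where all brackets vanish: the Christoffel symbol of the first
  kind.\<close>
definition koszul ::
  "('e::euclidean_space \<Rightarrow> 'e \<Rightarrow> 'e \<Rightarrow> real) \<Rightarrow> 'e \<Rightarrow> 'e \<Rightarrow> 'e \<Rightarrow> 'e \<Rightarrow> real" where
  "koszul G z u v w = (metric_deriv G z u v w + metric_deriv G z v u w - metric_deriv G z w u v) / 2"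

definition christoffel ::
  "('e::euclidean_space \<Rightarrow> 'e \<Rightarrow> 'e \<Rightarrow> real) \<Rightarrow> 'e \<Rightarrow> 'e \<Rightarrow> 'e \<Rightarrow> 'e" where
  "christoffel G z u v = raise (G z) (koszul G z u v)"

text \<open>The curvature operator in terms of the Christoffel symbols, that is, with coordinate fields in all three
  slots.\<close>
definition curv ::
  "('e::euclidean_space \<Rightarrow> 'e \<Rightarrow> 'e \<Rightarrow> real) \<Rightarrow> 'e \<Rightarrow> 'e \<Rightarrow> 'e \<Rightarrow> 'e \<Rightarrow> 'e" where
  "curv G z u v w =
     dir_deriv (\<lambda>y. christoffel G y v w) z u - dir_deriv (\<lambda>y. christoffel G y u w) z v
     + christoffel G z u (christoffel G z v w) - christoffel G z v (christoffel G z u w)"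

lemma curv_antisym: "curv G z v u w = - curv G z u v w"
  by (simp add: curv_def)

text \<open>The regularity used is that the coefficients are twice differentiable; this is what makes the
  Christoffel symbols differentiable, and hence the curvature computable.\<close>
locale local_metric =
  fixes G :: "'e::euclidean_space \<Rightarrow> 'e \<Rightarrow> 'e \<Rightarrow> real" and S :: "'e set"
  assumes open_dom: "open S"
    and form: "z \<in> S \<Longrightarrow> nondegenerate_form (G z)"
    and diff: "z \<in> S \<Longrightarrow> (\<lambda>y. G y u v) differentiable (at z)"
    and diff2: "z \<in> S \<Longrightarrow> (\<lambda>y. metric_deriv G y a u v) differentiable (at z)"
begin

lemma bil: "z \<in> S \<Longrightarrow> bilinear (G z)"
  using form by (rule nondegenerate_form.bil)

lemma sym: "z \<in> S \<Longrightarrow> G z u v = G z v u"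
  using form by (rule nondegenerate_form.sym)

lemma metric_has_derivative:
  "z \<in> S \<Longrightarrow> ((\<lambda>y. G y u v) has_derivative (\<lambda>a. metric_deriv G z a u v)) (at z)"
  unfolding metric_deriv_def using diff frechet_derivative_works by blast

lemma linear_metric_deriv1: "z \<in> S \<Longrightarrow> linear (\<lambda>a. metric_deriv G z a u v)"
  by (metis metric_has_derivative has_derivative_linear)

lemma metric_deriv_eqI:
  assumes "z \<in> S" "((\<lambda>y. G y u v) has_derivative D) (at z)"
  shows "metric_deriv G z a u v = D a"
  using metric_has_derivative[OF assms(1)] assms(2) by (metis has_derivative_unique)

lemma metric_deriv_sym: "z \<in> S \<Longrightarrow> metric_deriv G z a u v = metric_deriv G z a v u"
  by (rule metric_deriv_eqI, assumption,
      rule has_derivative_transform_within_open[OF metric_has_derivative open_dom]) (auto simp: sym)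

lemma linear_metric_deriv2:
  assumes z: "z \<in> S"
  shows "linear (\<lambda>u. metric_deriv G z a u v)"
proof (rule linearI)
  fix u u' r
  have "((\<lambda>y. G y (u + u') v) has_derivative (\<lambda>a. metric_deriv G z a u v + metric_deriv G z a u' v)) (at z)"
    by (rule has_derivative_transform_within_open[OF
        has_derivative_add[OF metric_has_derivative[OF z] metric_has_derivative[OF z]] open_dom z])
      (simp add: bilinear_ladd[OF bil])
  then show "metric_deriv G z a (u + u') v = metric_deriv G z a u v + metric_deriv G z a u' v"
    by (rule metric_deriv_eqI[OF z])
  have "((\<lambda>y. G y (r *\<^sub>R u) v) has_derivative (\<lambda>a. r *\<^sub>R metric_deriv G z a u v)) (at z)"
    by (rule has_derivative_transform_within_open[OF
        has_derivative_scaleR_right[OF metric_has_derivative[OF z]] open_dom z])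
      (simp add: bilinear_lmul[OF bil])
  then show "metric_deriv G z a (r *\<^sub>R u) v = r *\<^sub>R metric_deriv G z a u v"
    by (rule metric_deriv_eqI[OF z])
qed

lemma linear_metric_deriv3:
  assumes z: "z \<in> S"
  shows "linear (\<lambda>v. metric_deriv G z a u v)"
  unfolding metric_deriv_sym[OF z, of a u] by (rule linear_metric_deriv2[OF z])

lemmas metric_deriv_linear = linear_metric_deriv1 linear_metric_deriv2 linear_metric_deriv3

lemmas metric_deriv_simps [simp] =
  metric_deriv_linear[THEN linear_add] metric_deriv_linear[THEN linear_cmul]
  metric_deriv_linear[THEN linear_0]

lemma linear_koszul: "z \<in> S \<Longrightarrow> linear (koszul G z u v)"
  unfolding koszul_def
  by (rule linearI) (simp_all add: algebra_simps add_divide_distrib diff_divide_distrib)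

lemma christoffel_works:
  assumes "z \<in> S"
  shows "G z (christoffel G z u v) w = koszul G z u v w"
  unfolding christoffel_def
  using form[OF assms] linear_koszul[OF assms] by (rule nondegenerate_form.raise_works)

lemma christoffel_eqI:
  assumes "z \<in> S" "\<And>w. G z x w = koszul G z u v w"
  shows "christoffel G z u v = x"
  unfolding christoffel_def using form[OF assms(1)] assms(2) by (rule nondegenerate_form.raise_eqI)

lemma christoffel_0 [simp]:
  assumes z: "z \<in> S"
  shows "christoffel G z 0 v = 0" "christoffel G z u 0 = 0"
  by (rule christoffel_eqI[OF z]; simp add: koszul_def z bilinear_lzero[OF bil])+

lemma christoffel_add:
  assumes z: "z \<in> S"
  shows "christoffel G z u (v + v') = christoffel G z u v + christoffel G z u v'"
  by (rule christoffel_eqI[OF z])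
    (simp add: z bilinear_ladd[OF bil] christoffel_works, simp add: z koszul_def field_simps)

lemma christoffel_scale:
  assumes z: "z \<in> S"
  shows "christoffel G z u (r *\<^sub>R v) = r *\<^sub>R christoffel G z u v"
  by (rule christoffel_eqI[OF z])
    (simp add: z bilinear_lmul[OF bil] christoffel_works, simp add: z koszul_def field_simps)

text \<open>The raised vector solves the linear system whose matrix is the Gram operator of the metric.\<close>
lemma raise_differentiable:
  assumes z: "z \<in> S" and lin: "\<And>y. y \<in> S \<Longrightarrow> linear (l y)"
    and l: "\<And>w. (\<lambda>y. l y w) differentiable (at z)"
  shows "(\<lambda>y. raise (G y) (l y)) differentiable (at z)"
proof (rule differentiable_linear_solution[OF open_dom z])
  show "linear (nondegenerate_form.gram_operator (G y))" if "y \<in> S" for y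
    using form[OF that] by (rule nondegenerate_form.linear_gram_operator)
  show "inj (nondegenerate_form.gram_operator (G z))"
    using form[OF z] by (rule nondegenerate_form.inj_gram_operator)
  show "(\<lambda>y. nondegenerate_form.gram_operator (G y) u) differentiable (at z)" for u
  proof (rule differentiable_transform_open[OF _ open_dom z])
    show "(\<lambda>y. \<Sum>e\<in>Basis. G y u e *\<^sub>R e) differentiable (at z)"
      by (simp add: diff[OF z])
  qed (simp add: nondegenerate_form.gram_operator_def form)
  show "(\<lambda>y. \<Sum>e\<in>Basis. l y e *\<^sub>R e) differentiable (at z)"
    by (simp add: l)
  fix y assume y: "y \<in> S"
  then show "nondegenerate_form.gram_operator (G y) (raise (G y) (l y)) = (\<Sum>e\<in>Basis. l y e *\<^sub>R e)"
    using nondegenerate_form.raise_works[OF form lin]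
    by (simp add: nondegenerate_form.gram_operator_def form)
qed

lemma christoffel_differentiable:
  assumes z: "z \<in> S"
  shows "(\<lambda>y. christoffel G y u v) differentiable (at z)"
  unfolding christoffel_def
proof (rule raise_differentiable[OF z linear_koszul])
  show "(\<lambda>y. koszul G y u v w) differentiable (at z)" for w
    unfolding koszul_def divide_inverse
    by (intro differentiable_mult differentiable_diff differentiable_add diff2[OF z] differentiable_const)
qed

lemma christoffel_has_derivative:
  "z \<in> S \<Longrightarrow> ((\<lambda>y. christoffel G y u v) has_derivative dir_deriv (\<lambda>y. christoffel G y u v) z) (at z)"
  using christoffel_differentiable frechet_derivative_works by blast

lemma christoffel_sym:
  assumes z: "z \<in> S"
  shows "christoffel G z u v = christoffel G z v u"
  unfolding christoffel_def koszul_def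
  using metric_deriv_sym[OF z, of _ u v] by (simp add: add.commute)

lemma christoffel_add_left:
  "z \<in> S \<Longrightarrow> christoffel G z (u + u') v = christoffel G z u v + christoffel G z u' v"
  by (simp add: christoffel_sym[of z _ v] christoffel_add)

lemma dir_deriv_christoffel_add:
  assumes z: "z \<in> S"
  shows "dir_deriv (\<lambda>y. christoffel G y (u + u') v) z a
      = dir_deriv (\<lambda>y. christoffel G y u v) z a + dir_deriv (\<lambda>y. christoffel G y u' v) z a"
    and "dir_deriv (\<lambda>y. christoffel G y u (v + v')) z a
      = dir_deriv (\<lambda>y. christoffel G y u v) z a + dir_deriv (\<lambda>y. christoffel G y u v') z a"
    and "dir_deriv (\<lambda>y. christoffel G y u v) z (a + a')
      = dir_deriv (\<lambda>y. christoffel G y u v) z a + dir_deriv (\<lambda>y. christoffel G y u v) z a'"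
proof -
  show "dir_deriv (\<lambda>y. christoffel G y (u + u') v) z a
      = dir_deriv (\<lambda>y. christoffel G y u v) z a + dir_deriv (\<lambda>y. christoffel G y u' v) z a"
    by (rule dir_deriv_eq, rule has_derivative_transform_within_open[OF has_derivative_add[OF
          christoffel_has_derivative[OF z] christoffel_has_derivative[OF z]] open_dom z])
      (simp add: christoffel_add_left)
  show "dir_deriv (\<lambda>y. christoffel G y u (v + v')) z a
      = dir_deriv (\<lambda>y. christoffel G y u v) z a + dir_deriv (\<lambda>y. christoffel G y u v') z a"
    by (rule dir_deriv_eq, rule has_derivative_transform_within_open[OF has_derivative_add[OF
          christoffel_has_derivative[OF z] christoffel_has_derivative[OF z]] open_dom z])
      (simp add: christoffel_add)
  show "dir_deriv (\<lambda>y. christoffel G y u v) z (a + a')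
      = dir_deriv (\<lambda>y. christoffel G y u v) z a + dir_deriv (\<lambda>y. christoffel G y u v) z a'"
    by (rule linear_add[OF has_derivative_linear[OF christoffel_has_derivative[OF z]]])
qed

lemma curv_add:
  assumes z: "z \<in> S"
  shows "curv G z (u + u') v w = curv G z u v w + curv G z u' v w"
    and "curv G z u (v + v') w = curv G z u v w + curv G z u v' w"
    and "curv G z u v (w + w') = curv G z u v w + curv G z u v w'"
  by (simp_all add: curv_def dir_deriv_christoffel_add[OF z] christoffel_add[OF z]
      christoffel_add_left[OF z])

lemma pairing_has_derivative:
  assumes z: "z \<in> S" and Y: "(Y has_derivative Y') (at z)"
  shows "((\<lambda>y. G y (Y y) w) has_derivative (\<lambda>a. metric_deriv G z a (Y z) w + G z (Y' a) w)) (at z)"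
proof -
  have G: "G y u w = (\<Sum>e\<in>Basis. (u \<bullet> e) * G y e w)" if "y \<in> S" for y u
    using linear_expand[of "\<lambda>u. G y u w" u] bil[OF that] by (simp add: bilinear_def)
  have "((\<lambda>y. \<Sum>e\<in>Basis. (Y y \<bullet> e) * G y e w) has_derivative
      (\<lambda>a. \<Sum>e\<in>Basis. (Y z \<bullet> e) * metric_deriv G z a e w + (Y' a \<bullet> e) * G z e w)) (at z)"
    by (intro has_derivative_sum has_derivative_mult has_derivative_inner_left Y
        metric_has_derivative z)
  moreover have "(\<Sum>e\<in>Basis. (Y z \<bullet> e) * metric_deriv G z a e w + (Y' a \<bullet> e) * G z e w)
      = metric_deriv G z a (Y z) w + G z (Y' a) w" for a
    using linear_expand[OF linear_metric_deriv2[OF z], where u = "Y z"] G[OF z, of "Y' a"]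
    by (simp add: sum.distrib)
  ultimately have "((\<lambda>y. \<Sum>e\<in>Basis. (Y y \<bullet> e) * G y e w) has_derivative
      (\<lambda>a. metric_deriv G z a (Y z) w + G z (Y' a) w)) (at z)" by simp
  then show ?thesis
    by (rule has_derivative_transform_within_open[OF _ open_dom z]) (rule G[symmetric])
qed

text \<open>Only a constant first argument is treated, because the curvature at constant fields differentiates along
  constant fields only. The field \<open>Y\<close> may vary, and its brackets with the constant fields produce the term
  \<open>dir_deriv Y z u\<close>.\<close>
lemma nabla_const:
  assumes z: "z \<in> S" and Y: "Y differentiable (at z)"
  shows "nabla G (\<lambda>_. u) Y z = dir_deriv Y z u + christoffel G z u (Y z)"
  unfolding nabla_def
proof (rule nondegenerate_form.raise_eqI[OF form[OF z]])
  fix w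
  have Y': "(Y has_derivative dir_deriv Y z) (at z)" using Y frechet_derivative_works by blast
  have 1: "dir_deriv (\<lambda>y. G y (Y y) w) z u = metric_deriv G z u (Y z) w + G z (dir_deriv Y z u) w"
    by (rule dir_deriv_eq[OF pairing_has_derivative[OF z Y']])
  have 2: "dir_deriv (\<lambda>y. G y u w) z (Y z) = metric_deriv G z (Y z) u w"
    by (simp add: metric_deriv_def)
  have "((\<lambda>y. G y u (Y y)) has_derivative
      (\<lambda>a. metric_deriv G z a (Y z) u + G z (dir_deriv Y z a) u)) (at z)"
    by (rule has_derivative_transform_within_open[OF pairing_has_derivative[OF z Y'] open_dom z])
      (rule sym)
  then have 3: "dir_deriv (\<lambda>y. G y u (Y y)) z w
      = metric_deriv G z w (Y z) u + G z (dir_deriv Y z w) u"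
    by (rule dir_deriv_eq)
  show "G z (dir_deriv Y z u + christoffel G z u (Y z)) w =
     (dir_deriv (\<lambda>y. G y (Y y) w) z u + dir_deriv (\<lambda>y. G y u w) z (Y z)
      - dir_deriv (\<lambda>y. G y u (Y y)) z w
      + G z (lie_bracket (\<lambda>_. u) Y z) w
      - G z (lie_bracket (\<lambda>_. u) (\<lambda>_. w) z) (Y z)
      - G z (lie_bracket Y (\<lambda>_. w) z) u) / 2"
    unfolding 1 2 3
    by (simp add: lie_bracket_def bilinear_ladd[OF bil[OF z]] bilinear_lneg[OF bil[OF z]]
        bilinear_lzero[OF bil[OF z]] christoffel_works[OF z] koszul_def
        metric_deriv_sym[OF z, of w "Y z" u])
qed

lemma local_riemann_eq:
  assumes z: "z \<in> S"
  shows "local_riemann G z u v w = G z (curv G z u v w)"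
proof -
  have const: "nabla G (\<lambda>_. u) (\<lambda>_. v) y = christoffel G y u v" if "y \<in> S" for u v y
    using nabla_const[OF that, of "\<lambda>_. v" u] by simp
  have nn: "nabla G (\<lambda>_. u) (nabla G (\<lambda>_. v) (\<lambda>_. w)) z
      = dir_deriv (\<lambda>y. christoffel G y v w) z u + christoffel G z u (christoffel G z v w)" for u v w
  proof -
    have d: "(nabla G (\<lambda>_. v) (\<lambda>_. w)) differentiable (at z)"
      by (rule differentiable_transform_open[OF christoffel_differentiable[OF z] open_dom z])
        (simp add: const)
    have "dir_deriv (nabla G (\<lambda>_. v) (\<lambda>_. w)) z = dir_deriv (\<lambda>y. christoffel G y v w) z"
      by (rule frechet_derivative_transform_within_open[OF d open_dom z const])
    then show ?thesis by (simp add: nabla_const[OF z d] const[OF z])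
  qed
  have "lie_bracket (\<lambda>_. u) (\<lambda>_. v) = (\<lambda>_. 0)" by (simp add: lie_bracket_def fun_eq_iff)
  then have "nabla G (lie_bracket (\<lambda>_. u) (\<lambda>_. v)) (\<lambda>_. w) z = 0"
    by (simp add: const z)
  then show ?thesis
    by (simp add: local_riemann_def curvature_operator_def nn curv_def fun_eq_iff algebra_simps)
qed

end


section \<open>Curvature of a warped product in a product chart\<close>

lemma has_derivative_comp_fst:
  "(F has_derivative F') (at (fst z)) \<Longrightarrow> ((\<lambda>z. F (fst z)) has_derivative (\<lambda>A. F' (fst A))) (at z)"
  by (rule has_derivative_compose[where f = fst and g = F]) (auto intro: derivative_intros)

lemma has_derivative_comp_snd:
  "(F has_derivative F') (at (snd z)) \<Longrightarrow> ((\<lambda>z. F (snd z)) has_derivative (\<lambda>A. F' (snd A))) (at z)"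
  by (rule has_derivative_compose[where f = snd and g = F]) (auto intro: derivative_intros)

text \<open>The two factors and the product share one notion of local metric, so that everything above applies to
  \<open>g\<close>, \<open>h\<close> and \<open>W\<close> alike. The equation for \<open>W\<close> is demanded on \<open>S \<times> T\<close> only, since an inverse chart of a product
  is unspecified elsewhere.\<close>
locale local_warped_product =
  base: local_metric g S + fiber: local_metric h T
  for g :: "'e::euclidean_space \<Rightarrow> 'e \<Rightarrow> 'e \<Rightarrow> real" and S
    and h :: "'f::euclidean_space \<Rightarrow> 'f \<Rightarrow> 'f \<Rightarrow> real" and T +
  fixes \<phi> :: "'e \<Rightarrow> real" and W :: "'e \<times> 'f \<Rightarrow> 'e \<times> 'f \<Rightarrow> 'e \<times> 'f \<Rightarrow> real"
  assumes \<phi>_pos: "x \<in> S \<Longrightarrow> \<phi> x > 0"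
    and \<phi>_diff: "x \<in> S \<Longrightarrow> \<phi> differentiable (at x)"
    and \<phi>_diff2: "x \<in> S \<Longrightarrow> (\<lambda>y. dir_deriv \<phi> y a) differentiable (at x)"
    and W_eq: "z \<in> S \<times> T \<Longrightarrow>
      W z U V = g (fst z) (fst U) (fst V) + \<phi> (fst z) * h (snd z) (snd U) (snd V)"
begin

lemma \<phi>_has_derivative: "x \<in> S \<Longrightarrow> (\<phi> has_derivative dir_deriv \<phi> x) (at x)"
  using \<phi>_diff frechet_derivative_works by blast

lemma linear_d\<phi>: "x \<in> S \<Longrightarrow> linear (dir_deriv \<phi> x)"
  using \<phi>_has_derivative has_derivative_linear by blast

lemma open_times: "open (S \<times> T)"
  using base.open_dom fiber.open_dom by (rule open_Times)

lemma metric_deriv_warped: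
  assumes "z \<in> S \<times> T"
  shows "metric_deriv W z A U V =
    metric_deriv g (fst z) (fst A) (fst U) (fst V)
    + dir_deriv \<phi> (fst z) (fst A) * h (snd z) (snd U) (snd V)
    + \<phi> (fst z) * metric_deriv h (snd z) (snd A) (snd U) (snd V)"
    (is ?eq)
  and W_differentiable: "(\<lambda>y. W y U V) differentiable (at z)"
proof -
  have x: "fst z \<in> S" and y: "snd z \<in> T" using assms by auto
  have "((\<lambda>z. g (fst z) (fst U) (fst V) + \<phi> (fst z) * h (snd z) (snd U) (snd V)) has_derivative
    (\<lambda>A. metric_deriv g (fst z) (fst A) (fst U) (fst V)
      + (\<phi> (fst z) * metric_deriv h (snd z) (snd A) (snd U) (snd V)
        + dir_deriv \<phi> (fst z) (fst A) * h (snd z) (snd U) (snd V)))) (at z)"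
    by (intro has_derivative_add has_derivative_mult has_derivative_comp_fst has_derivative_comp_snd
        base.metric_has_derivative[OF x] fiber.metric_has_derivative[OF y] \<phi>_has_derivative[OF x])
  then have d: "((\<lambda>z. W z U V) has_derivative
    (\<lambda>A. metric_deriv g (fst z) (fst A) (fst U) (fst V)
      + (\<phi> (fst z) * metric_deriv h (snd z) (snd A) (snd U) (snd V)
        + dir_deriv \<phi> (fst z) (fst A) * h (snd z) (snd U) (snd V)))) (at z)"
    by (rule has_derivative_transform_within_open[OF _ open_times assms]) (rule W_eq[symmetric])
  show ?eq unfolding metric_deriv_def[of W] by (subst dir_deriv_eq[OF d]) simp
  show "(\<lambda>y. W y U V) differentiable (at z)" using d by (rule differentiableI)
qed

sublocale total: local_metric W "S \<times> T"
proof (rule local_metric.intro)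
  show "open (S \<times> T)" by (rule open_times)
next
  fix z :: "'e \<times> 'f" assume z: "z \<in> S \<times> T"
  then have x: "fst z \<in> S" and y: "snd z \<in> T" by auto
  note W = W_eq[OF z] and G = base.bil[OF x] and H = fiber.bil[OF y]
  show "nondegenerate_form (W z)"
  proof
    show "bilinear (W z)"
      unfolding bilinear_def
      by (intro conjI allI linearI)
        (simp_all add: W bilinear_ladd[OF G] bilinear_radd[OF G] bilinear_ladd[OF H] bilinear_radd[OF H]
          bilinear_lmul[OF G] bilinear_rmul[OF G] bilinear_lmul[OF H] bilinear_rmul[OF H] algebra_simps)
    show "W z u v = W z v u" for u v
      by (simp add: W base.sym[OF x, of "fst u"] fiber.sym[OF y, of "snd u"])
    fix U assume U: "\<And>V. W z U V = 0"
    have "fst U = 0"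
    proof (rule nondegenerate_form.nondeg[OF base.form[OF x]])
      show "g (fst z) (fst U) v = 0" for v
        using U[of "(v, 0)"] by (simp add: W bilinear_rzero[OF H])
    qed
    moreover have "snd U = 0"
    proof (rule nondegenerate_form.nondeg[OF fiber.form[OF y]])
      show "h (snd z) (snd U) v = 0" for v
        using U[of "(0, v)"] \<phi>_pos[OF x] by (simp add: W bilinear_rzero[OF G])
    qed
    ultimately show "U = 0" by (simp add: prod_eq_iff)
  qed
  show "(\<lambda>y. W y u v) differentiable (at z)" for u v by (rule W_differentiable[OF z])
  have cf: "(\<lambda>z. F (fst z)) differentiable (at z)" if "F differentiable (at (fst z))" for F :: "'e \<Rightarrow> real"
    using that has_derivative_comp_fst unfolding differentiable_def by blast
  have cs: "(\<lambda>z. F (snd z)) differentiable (at z)" if "F differentiable (at (snd z))" for F :: "'f \<Rightarrow> real"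
    using that has_derivative_comp_snd unfolding differentiable_def by blast
  show "(\<lambda>y. metric_deriv W y A U V) differentiable (at z)" for A U V
  proof (rule differentiable_transform_open[OF _ open_times z metric_deriv_warped(1)[symmetric]])
    show "(\<lambda>z. metric_deriv g (fst z) (fst A) (fst U) (fst V)
        + dir_deriv \<phi> (fst z) (fst A) * h (snd z) (snd U) (snd V)
        + \<phi> (fst z) * metric_deriv h (snd z) (snd A) (snd U) (snd V)) differentiable (at z)"
      by (intro differentiable_add differentiable_mult cf cs base.diff2[OF x] fiber.diff2[OF y]
          fiber.diff[OF y] \<phi>_diff[OF x] \<phi>_diff2[OF x])
  qed
qed

definition grad :: "'e \<Rightarrow> 'e" where
  "grad x = raise (g x) (dir_deriv \<phi> x)"

text \<open>Half the logarithmic derivative of the warping function, that is \<open>d (ln (sqrt \<phi>))\<close>.\<close>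
definition half_dlog :: "'e \<Rightarrow> 'e \<Rightarrow> real" where
  "half_dlog x a = dir_deriv \<phi> x a / (2 * \<phi> x)"

lemma grad_works: "x \<in> S \<Longrightarrow> g x (grad x) w = dir_deriv \<phi> x w"
  unfolding grad_def by (rule nondegenerate_form.raise_works[OF base.form linear_d\<phi>])

lemma grad_has_derivative: "x \<in> S \<Longrightarrow> (grad has_derivative dir_deriv grad x) (at x)"
  unfolding frechet_derivative_works[symmetric] grad_def
  by (rule base.raise_differentiable[OF _ linear_d\<phi> \<phi>_diff2])

lemma half_dlog_0: "x \<in> S \<Longrightarrow> half_dlog x 0 = 0"
  using linear_0[OF linear_d\<phi>] by (simp add: half_dlog_def)

lemma half_dlog_scale: "x \<in> S \<Longrightarrow> half_dlog x (r *\<^sub>R a) = r * half_dlog x a"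
  using linear_cmul[OF linear_d\<phi>] by (simp add: half_dlog_def)

lemma half_dlog_has_derivative:
  "x \<in> S \<Longrightarrow> ((\<lambda>y. half_dlog y a) has_derivative dir_deriv (\<lambda>y. half_dlog y a) x) (at x)"
  unfolding frechet_derivative_works[symmetric] half_dlog_def
  using \<phi>_pos[of x]
  by (intro differentiable_divide \<phi>_diff2 differentiable_mult differentiable_const \<phi>_diff) auto

text \<open>Found by solving Koszul's formula for the two components. Besides the symbols of the factors, testing against
  base vectors leaves \<open>- h (U, V) d\<phi> / 2\<close>, hence the gradient, and testing against fiber vectors leaves the
  terms with \<open>d\<phi>\<close> divided by the factor \<open>\<phi>\<close> of the fiber metric.\<close>
lemma christoffel_warped:
  assumes z: "z \<in> S \<times> T"
  shows "christoffel W z U V =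
    (christoffel g (fst z) (fst U) (fst V) - (h (snd z) (snd U) (snd V) / 2) *\<^sub>R grad (fst z),
     christoffel h (snd z) (snd U) (snd V)
       + half_dlog (fst z) (fst U) *\<^sub>R snd V + half_dlog (fst z) (fst V) *\<^sub>R snd U)"
proof (rule total.christoffel_eqI[OF z])
  fix X
  have x: "fst z \<in> S" and y: "snd z \<in> T" using z by auto
  note G = base.bil[OF x] and H = fiber.bil[OF y]
  have "\<phi> (fst z) * half_dlog (fst z) a = dir_deriv \<phi> (fst z) a / 2" for a
    using \<phi>_pos[OF x] by (simp add: half_dlog_def)
  then have 1: "\<phi> (fst z) * (half_dlog (fst z) a * r) = dir_deriv \<phi> (fst z) a / 2 * r" for a r
    by (metis mult.assoc)
  show "W z (christoffel g (fst z) (fst U) (fst V) - (h (snd z) (snd U) (snd V) / 2) *\<^sub>R grad (fst z),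
     christoffel h (snd z) (snd U) (snd V)
       + half_dlog (fst z) (fst U) *\<^sub>R snd V + half_dlog (fst z) (fst V) *\<^sub>R snd U) X
    = koszul W z U V X"
    by (simp add: W_eq[OF z] bilinear_lsub[OF G] bilinear_lmul[OF G] bilinear_ladd[OF H]
        bilinear_lmul[OF H] base.christoffel_works[OF x] fiber.christoffel_works[OF y] grad_works[OF x]
        distrib_left 1)
      (simp add: koszul_def metric_deriv_warped[OF z] field_simps)
qed

lemma dir_deriv_christoffel:
  assumes z: "z \<in> S \<times> T" and F: "(F has_derivative F') (at z)"
    and eq: "\<And>y. y \<in> S \<times> T \<Longrightarrow> christoffel W y U V = F y"
  shows "dir_deriv (\<lambda>y. christoffel W y U V) z A = F' A"
  by (rule dir_deriv_eq, rule has_derivative_transform_within_open[OF F open_times z])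
    (simp add: eq)

lemma zero_forms:
  assumes "z \<in> S \<times> T"
  shows "h (snd z) 0 \<gamma> = 0" "h (snd z) \<gamma> 0 = 0" "g (fst z) 0 c = 0" "g (fst z) c 0 = 0"
    "half_dlog (fst z) 0 = 0"
    "christoffel g (fst z) 0 c = 0" "christoffel g (fst z) c 0 = 0"
    "christoffel h (snd z) 0 \<gamma> = 0" "christoffel h (snd z) \<gamma> 0 = 0"
  using assms
  by (auto simp: mem_Times_iff bilinear_lzero[OF fiber.bil] bilinear_rzero[OF fiber.bil] half_dlog_0
      bilinear_lzero[OF base.bil] bilinear_rzero[OF base.bil])

text \<open>Two base vectors act by preserving both factors, a base and a fiber vector by exchanging them. As soon as
  one argument is a base vector, fiber vectors enter the value only through scalar multiples and through
  \<open>h\<close>; the curvature of the fiber appears only when all three arguments are fiber vectors.\<close>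
context
  fixes z :: "'e \<times> 'f" assumes z: "z \<in> S \<times> T"
begin

lemma base_point: "fst z \<in> S" and fiber_point: "snd z \<in> T"
  using z by auto

lemma deriv_base_base:
  "dir_deriv (\<lambda>y. christoffel W y (a, 0) (c, 0)) z A
    = (dir_deriv (\<lambda>y. christoffel g y a c) (fst z) (fst A), 0)"
  by (rule dir_deriv_christoffel[OF z has_derivative_Pair[OF has_derivative_comp_fst[OF
          base.christoffel_has_derivative[OF base_point]] has_derivative_const]])
    (simp add: christoffel_warped zero_forms)

lemma deriv_mixed:
  "dir_deriv (\<lambda>y. christoffel W y (a, 0) (0, \<gamma>)) z A
    = (0, dir_deriv (\<lambda>x. half_dlog x a) (fst z) (fst A) *\<^sub>R \<gamma>)"
  "dir_deriv (\<lambda>y. christoffel W y (0, \<gamma>) (a, 0)) z A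
    = (0, dir_deriv (\<lambda>x. half_dlog x a) (fst z) (fst A) *\<^sub>R \<gamma>)"
  by (rule dir_deriv_christoffel[OF z has_derivative_Pair[OF has_derivative_const
        has_derivative_scaleR_left[OF has_derivative_comp_fst[OF half_dlog_has_derivative[OF base_point]]]]],
      simp add: christoffel_warped zero_forms)+

lemma deriv_fiber_fiber:
  "dir_deriv (\<lambda>y. christoffel W y (0, \<beta>) (0, \<gamma>)) z A
    = ((- 1 / 2) *\<^sub>R (h (snd z) \<beta> \<gamma> *\<^sub>R dir_deriv grad (fst z) (fst A)
          + metric_deriv h (snd z) (snd A) \<beta> \<gamma> *\<^sub>R grad (fst z)),
       dir_deriv (\<lambda>y. christoffel h y \<beta> \<gamma>) (snd z) (snd A))"
  by (rule dir_deriv_christoffel[OF z has_derivative_Pair[OF has_derivative_scaleR_right[OF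
        has_derivative_scaleR[OF has_derivative_comp_snd[OF fiber.metric_has_derivative[OF fiber_point]]
         has_derivative_comp_fst[OF grad_has_derivative[OF base_point]]]]
        has_derivative_comp_snd[OF fiber.christoffel_has_derivative[OF fiber_point]]]])
    (simp add: christoffel_warped zero_forms)

lemma curv_base:
  "curv W z (a, 0) (b, 0) (c, 0) = (curv g (fst z) a b c, 0)"
  by (simp add: curv_def deriv_base_base christoffel_warped[OF z] zero_forms[OF z])

lemma curv_base_base_fiber:
  "curv W z (a, 0) (b, 0) (0, \<gamma>) =
    (0, (dir_deriv (\<lambda>x. half_dlog x b) (fst z) a - dir_deriv (\<lambda>x. half_dlog x a) (fst z) b) *\<^sub>R \<gamma>)"
  by (simp add: curv_def deriv_mixed christoffel_warped[OF z] zero_forms[OF z] algebra_simps)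

lemma curv_base_fiber_base:
  "curv W z (a, 0) (0, \<beta>) (c, 0) =
    (0, (dir_deriv (\<lambda>x. half_dlog x c) (fst z) a + half_dlog (fst z) a * half_dlog (fst z) c
         - half_dlog (fst z) (christoffel g (fst z) a c)) *\<^sub>R \<beta>)"
  using linear_0[OF has_derivative_linear[OF base.christoffel_has_derivative[OF base_point]], of a c]
  by (simp add: curv_def deriv_mixed deriv_base_base christoffel_warped[OF z] zero_forms[OF z] algebra_simps)

lemma curv_base_fiber_fiber:
  "curv W z (a, 0) (0, \<beta>) (0, \<gamma>) =
    (h (snd z) \<beta> \<gamma> *\<^sub>R ((1 / 2) *\<^sub>R (half_dlog (fst z) a *\<^sub>R grad (fst z)
       - dir_deriv grad (fst z) a - christoffel g (fst z) a (grad (fst z)))), 0)"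
proof -
  note D0 = linear_0[OF has_derivative_linear[OF half_dlog_has_derivative[OF base_point]]]
    linear_0[OF has_derivative_linear[OF fiber.christoffel_has_derivative[OF fiber_point]]]
  have "christoffel g (fst z) a (- (r *\<^sub>R w)) = - (r *\<^sub>R christoffel g (fst z) a w)" for r w
    using base.christoffel_scale[OF base_point, of a "- r" w] by simp
  moreover have "h (snd z) (r *\<^sub>R \<beta>) \<gamma> = r * h (snd z) \<beta> \<gamma>"
    "h (snd z) \<beta> (r *\<^sub>R \<gamma>) = r * h (snd z) \<beta> \<gamma>" for r
    using fiber.bil[OF fiber_point] by (simp_all add: bilinear_lmul bilinear_rmul)
  ultimately show ?thesis
    by (simp add: curv_def deriv_mixed deriv_fiber_fiber christoffel_warped[OF z] zero_forms[OF z]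
        D0 fiber.metric_deriv_simps[OF fiber_point] fiber.christoffel_scale[OF fiber_point] algebra_simps)
qed

lemma curv_fiber:
  "snd (curv W z (0, \<alpha>) (0, \<beta>) (0, \<gamma>)) = curv h (snd z) \<alpha> \<beta> \<gamma>
     - (half_dlog (fst z) (grad (fst z)) / 2)
       *\<^sub>R (h (snd z) \<beta> \<gamma> *\<^sub>R \<alpha> - h (snd z) \<alpha> \<gamma> *\<^sub>R \<beta>)"
proof -
  have "half_dlog (fst z) (- (r *\<^sub>R w)) = - (r * half_dlog (fst z) w)" for r w
    using half_dlog_scale[OF base_point, of "- r" w] by simp
  then show ?thesis
    by (simp add: curv_def deriv_fiber_fiber christoffel_warped[OF z] zero_forms[OF z] algebra_simps)
qed

end

end


section \<open>Tensors of order four acting on each other\<close>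

lemma derivation_action_tensor4:
  "derivation_action b D (of_tensor4 H) [x0, x1, x2, x3] X Y =
     - (H (tensor_endo b D X Y x0) x1 x2 x3 + H x0 (tensor_endo b D X Y x1) x2 x3
        + H x0 x1 (tensor_endo b D X Y x2) x3 + H x0 x1 x2 (tensor_endo b D X Y x3))"
  by (simp add: derivation_action_def of_tensor4_def lessThan_Suc eval_nat_numeral)

lemma tachibana_tensor4:
  "tachibana A (of_tensor4 H) [x0, x1, x2, x3] X Y =
     A X x0 * H Y x1 x2 x3 - A Y x0 * H X x1 x2 x3
     + (A X x1 * H x0 Y x2 x3 - A Y x1 * H x0 X x2 x3)
     + (A X x2 * H x0 x1 Y x3 - A Y x2 * H x0 x1 X x3)
     + (A X x3 * H x0 x1 x2 Y - A Y x3 * H x0 x1 x2 X)"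
  by (simp add: tachibana_def of_tensor4_def lessThan_Suc eval_nat_numeral)

context local_warped_product
begin

text \<open>Both corrections to the Ricci tensor of the fiber are multiples of \<open>h\<close>: the trace over the base because
  the operator of a base and a fiber vector maps \<open>\<gamma>\<close> to \<open>h \<beta> \<gamma>\<close> times a base vector independent of \<open>\<beta>\<close> and \<open>\<gamma>\<close>, the trace
  over the fiber because the extra term there is that of constant curvature.\<close>
lemma ricci_fiber:
  assumes z: "z \<in> S \<times> T"
  obtains C where "\<And>\<beta> \<gamma>. (\<Sum>A\<in>Basis. curv W z A (0, \<beta>) (0, \<gamma>) \<bullet> A)
    = (\<Sum>\<alpha>\<in>Basis. curv h (snd z) \<alpha> \<beta> \<gamma> \<bullet> \<alpha>) + C * h (snd z) \<beta> \<gamma>"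
proof -
  have y: "snd z \<in> T" using z by auto
  let ?\<nu> = "\<lambda>a. (1 / 2) *\<^sub>R (half_dlog (fst z) a *\<^sub>R grad (fst z)
       - dir_deriv grad (fst z) a - christoffel g (fst z) a (grad (fst z)))"
  define t where "t = half_dlog (fst z) (grad (fst z)) / 2"
  have split: "(\<Sum>A\<in>Basis. F A) = (\<Sum>a\<in>Basis. F (a, 0)) + (\<Sum>\<alpha>\<in>Basis. F (0, \<alpha>))"
    for F :: "'e \<times> 'f \<Rightarrow> real"
    unfolding Basis_prod_def
    by (subst sum.union_disjoint) (auto simp: sum.reindex inj_on_def)
  have "(\<Sum>A\<in>Basis. curv W z A (0, \<beta>) (0, \<gamma>) \<bullet> A)
    = (\<Sum>\<alpha>\<in>Basis. curv h (snd z) \<alpha> \<beta> \<gamma> \<bullet> \<alpha>)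
      + ((\<Sum>a\<in>Basis. ?\<nu> a \<bullet> a) - t * (real DIM('f) - 1)) * h (snd z) \<beta> \<gamma>" for \<beta> \<gamma>
  proof -
    have "(\<Sum>a\<in>Basis. curv W z (a, 0) (0, \<beta>) (0, \<gamma>) \<bullet> (a, 0)) = h (snd z) \<beta> \<gamma> * (\<Sum>a\<in>Basis. ?\<nu> a \<bullet> a)"
      unfolding sum_distrib_left curv_base_fiber_fiber[OF z] by simp
    moreover have "(\<Sum>\<alpha>\<in>Basis. curv W z (0, \<alpha>) (0, \<beta>) (0, \<gamma>) \<bullet> (0, \<alpha>))
      = (\<Sum>\<alpha>\<in>Basis. curv h (snd z) \<alpha> \<beta> \<gamma> \<bullet> \<alpha>) - t * (real DIM('f) - 1) * h (snd z) \<beta> \<gamma>"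
    proof -
      have "linear (\<lambda>u. h (snd z) u \<gamma>)" using fiber.bil[OF y] by (simp add: bilinear_def)
      from linear_expand[OF this, of \<beta>]
      have e: "(\<Sum>\<alpha>\<in>Basis. h (snd z) \<alpha> \<gamma> * (\<beta> \<bullet> \<alpha>)) = h (snd z) \<beta> \<gamma>" by (simp add: mult.commute)
      have "(\<Sum>\<alpha>\<in>Basis. curv W z (0, \<alpha>) (0, \<beta>) (0, \<gamma>) \<bullet> (0, \<alpha>))
        = (\<Sum>\<alpha>\<in>Basis. curv h (snd z) \<alpha> \<beta> \<gamma> \<bullet> \<alpha>
             - t * (h (snd z) \<beta> \<gamma> - h (snd z) \<alpha> \<gamma> * (\<beta> \<bullet> \<alpha>)))"
        by (rule sum.cong)
          (simp_all add: inner_prod_def curv_fiber[OF z] t_def inner_diff_left inner_Basis)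
      also have "\<dots> = (\<Sum>\<alpha>\<in>Basis. curv h (snd z) \<alpha> \<beta> \<gamma> \<bullet> \<alpha>)
          - t * (real DIM('f) * h (snd z) \<beta> \<gamma> - h (snd z) \<beta> \<gamma>)"
        by (simp add: sum_subtractf sum_distrib_left[symmetric] e)
      finally show ?thesis by (simp add: algebra_simps)
    qed
    ultimately show ?thesis unfolding split by (simp add: algebra_simps)
  qed
  then show thesis by (rule that)
qed

text \<open>The heart of the argument, for a tensor \<open>P\<close> built like the projective one but from an arbitrary
  function \<open>Q\<close> in place of the Ricci tensor. With three base vectors and one fiber vector in the slots of \<open>R\<close>,
  acted upon by a base and a fiber vector, all terms but one are multiples of \<open>h \<beta> \<alpha>\<close>. The exception comes from
  the last slot, where \<open>P\<close> sends \<open>\<alpha>\<close> to \<open>- k Q(\<beta>, \<alpha>) d\<close> plus vectors contributing multiples of \<open>h \<beta> \<alpha>\<close>; it is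
  the left-hand side of the conclusion.\<close>
lemma fiber_block_proportional:
  fixes k L :: real and Q :: "'e \<times> 'f \<Rightarrow> 'e \<times> 'f \<Rightarrow> real"
  assumes z: "z \<in> S \<times> T"
  defines "R \<equiv> \<lambda>U V Z. W z (curv W z U V Z)"
  defines "P \<equiv> \<lambda>U V Z X. R U V Z X - k * (Q V Z * W z U X - Q U Z * W z V X)"
  assumes eq: "\<And>\<alpha> \<beta>. derivation_action (W z) P (of_tensor4 R) [(a, 0), (b, 0), (c, 0), (0, \<alpha>)] (d, 0) (0, \<beta>)
    = L * tachibana (W z) (of_tensor4 R) [(a, 0), (b, 0), (c, 0), (0, \<alpha>)] (d, 0) (0, \<beta>)"
  obtains C where "\<And>\<alpha> \<beta>. k * Q (0, \<beta>) (0, \<alpha>) * g (fst z) (curv g (fst z) a b c) d = C * h (snd z) \<beta> \<alpha>"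
proof -
  have x: "fst z \<in> S" and y: "snd z \<in> T" using z by auto
  note G = base.bil[OF x] and H = fiber.bil[OF y] and Z = zero_forms[OF z]
  obtain \<tau> where \<tau>: "\<And>a \<beta> c. curv W z (a, 0) (0, \<beta>) (c, 0) = (0, \<tau> a c *\<^sub>R \<beta>)"
    by (rule that, rule curv_base_fiber_base[OF z])
  obtain \<omega> where \<omega>: "\<And>a b \<gamma>. curv W z (a, 0) (b, 0) (0, \<gamma>) = (0, \<omega> a b *\<^sub>R \<gamma>)"
    by (rule that, rule curv_base_base_fiber[OF z])
  obtain \<nu> where \<nu>: "\<And>a \<beta> \<gamma>. curv W z (a, 0) (0, \<beta>) (0, \<gamma>) = (h (snd z) \<beta> \<gamma> *\<^sub>R \<nu> a, 0)"
    by (rule that, rule curv_base_fiber_fiber[OF z])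
  have split: "(p, q) = (p, 0) + (0, q)" for p :: 'e and q :: 'f by simp
  \<comment> \<open>These four facts replace one slot of \<open>R(a, b, c, \<alpha>)\<close> by an arbitrary vector. Both the derivation and the
    Tachibana tensor only ever do this.\<close>
  have R0: "R (p, q) (b, 0) (c, 0) (0, \<alpha>) = - \<tau> b c * (\<phi> (fst z) * h (snd z) q \<alpha>)" for p q b c \<alpha>
  proof -
    have "curv W z (p, q) (b, 0) (c, 0) = (curv g (fst z) p b c, - (\<tau> b c *\<^sub>R q))"
      by (subst split, subst total.curv_add[OF z], subst curv_antisym[of W z "(0, q)"])
        (simp add: curv_base[OF z] \<tau>)
    then show ?thesis
      by (simp add: R_def W_eq[OF z] Z bilinear_lneg[OF H] bilinear_lmul[OF H])
  qed
  have R1: "R (a, 0) (p, q) (c, 0) (0, \<alpha>) = \<tau> a c * (\<phi> (fst z) * h (snd z) q \<alpha>)" for p q a c \<alpha>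
  proof -
    have "curv W z (a, 0) (p, q) (c, 0) = (curv g (fst z) a p c, \<tau> a c *\<^sub>R q)"
      by (subst split, subst total.curv_add[OF z]) (simp add: curv_base[OF z] \<tau>)
    then show ?thesis by (simp add: R_def W_eq[OF z] Z bilinear_lmul[OF H])
  qed
  have R2: "R (a, 0) (b, 0) (p, q) (0, \<alpha>) = \<omega> a b * (\<phi> (fst z) * h (snd z) q \<alpha>)" for p q a b \<alpha>
  proof -
    have "curv W z (a, 0) (b, 0) (p, q) = (curv g (fst z) a b p, \<omega> a b *\<^sub>R q)"
      by (subst split, subst total.curv_add[OF z]) (simp add: curv_base[OF z] \<omega>)
    then show ?thesis by (simp add: R_def W_eq[OF z] Z bilinear_lmul[OF H])
  qed
  have R3: "R (a, 0) (b, 0) (c, 0) (p, q) = g (fst z) (curv g (fst z) a b c) p" for p q a b c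
    by (simp add: R_def W_eq[OF z] Z curv_base[OF z])
  have E: "tensor_endo (W z) P X Y V = curv W z X Y V - k *\<^sub>R (Q Y V *\<^sub>R X - Q X V *\<^sub>R Y)" for X Y V
  proof -
    have "P X Y V = W z (curv W z X Y V - k *\<^sub>R (Q Y V *\<^sub>R X - Q X V *\<^sub>R Y))"
      using total.bil[OF z] by (simp add: P_def R_def fun_eq_iff bilinear_lsub bilinear_lmul)
    then show ?thesis
      by (simp add: tensor_endo_def nondegenerate_form.raise_form[OF total.form[OF z]])
  qed
  let ?r = "g (fst z) (curv g (fst z) a b c) d"
  let ?\<tau>' = "\<lambda>e. \<tau> d e + k * Q (d, 0) (e, 0)"
  \<comment> \<open>Solve the hypothesis for the one term that contains \<open>Q (0, \<beta>) (0, \<alpha>)\<close>; the first two lines stem from the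
    derivation, the last one from the Tachibana tensor.\<close>
  let ?C = "g (fst z) (curv g (fst z) a b c) (\<nu> d)
    + \<phi> (fst z) * (?\<tau>' b * \<tau> a c + ?\<tau>' c * \<omega> a b - ?\<tau>' a * \<tau> b c)
    + L * \<phi> (fst z) * (g (fst z) d b * \<tau> a c + g (fst z) d c * \<omega> a b - g (fst z) d a * \<tau> b c - ?r)"
  have "k * Q (0, \<beta>) (0, \<alpha>) * ?r = ?C * h (snd z) \<beta> \<alpha>" for \<alpha> \<beta>
    using eq[of \<alpha> \<beta>]
    unfolding derivation_action_tensor4 tachibana_tensor4 E
    by (simp add: \<tau> \<nu> R0 R1 R2 R3 Z W_eq[OF z] bilinear_ladd[OF H] bilinear_lmul[OF H]
        bilinear_rsub[OF G] bilinear_rmul[OF G] bilinear_lsub[OF H])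
      (simp add: algebra_simps)
  then show thesis by (rule that)
qed

end


section \<open>From charts to manifolds\<close>

lemma smooth_on_differentiable: "smooth_on S F \<Longrightarrow> x \<in> S \<Longrightarrow> F differentiable (at x)"
  unfolding smooth_on_def by (metis Ck_on.simps(2))

lemma smooth_on_dir_deriv: "smooth_on S F \<Longrightarrow> smooth_on S (\<lambda>x. dir_deriv F x v)"
  unfolding smooth_on_def by (metis Ck_on.simps(2))

lemma inj_on_chart:
  assumes "smooth_manifold M" "i \<in> charts M"
  shows "inj_on (cmap M i) (cdom M i)"
proof -
  have hm: "homeomorphic_map (subtopology (mtop M) (cdom M i)) (top_of_set (cimg M i)) (cmap M i)"
    and op: "openin (mtop M) (cdom M i)"
    using assms unfolding smooth_manifold_def by blast+
  have "topspace (subtopology (mtop M) (cdom M i)) = cdom M i"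
    using openin_subset[OF op] by (simp add: Int_absorb1)
  then show ?thesis using homeomorphic_imp_injective_map[OF hm] by simp
qed

lemma open_cimg: "smooth_manifold M \<Longrightarrow> i \<in> charts M \<Longrightarrow> open (cimg M i)"
  unfolding smooth_manifold_def by blast

lemma cdom_subset: "smooth_manifold M \<Longrightarrow> i \<in> charts M \<Longrightarrow> cdom M i \<subseteq> topspace (mtop M)"
  unfolding smooth_manifold_def by blast

lemma cinv_in_cdom: "y \<in> cimg M i \<Longrightarrow> cinv M i y \<in> cdom M i"
  unfolding cimg_def cinv_def by (rule inv_into_into)

lemma cmap_cinv: "y \<in> cimg M i \<Longrightarrow> cmap M i (cinv M i y) = y"
  unfolding cimg_def cinv_def by (rule f_inv_into_f)

lemma cinv_cmap:
  "smooth_manifold M \<Longrightarrow> i \<in> charts M \<Longrightarrow> x \<in> cdom M i \<Longrightarrow> cinv M i (cmap M i x) = x"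
  unfolding cinv_def by (rule inv_into_f_f[OF inj_on_chart])

lemma cmap_in_cimg: "x \<in> cdom M i \<Longrightarrow> cmap M i x \<in> cimg M i"
  unfolding cimg_def by blast

lemma semi_riemannian_form:
  assumes "semi_riemannian_manifold M g" "i \<in> charts M" "x \<in> cdom M i"
  shows "nondegenerate_form (g i x)"
proof
  have "semi_riemannian_metric M g" using assms(1) by (simp add: semi_riemannian_manifold_def)
  note s = this[unfolded semi_riemannian_metric_def, THEN conjunct1, rule_format, OF assms(2,3)]
  show "bilinear (g i x)" and "g i x u v = g i x v u" for u v using s by blast+
  show "u = 0" if "\<And>v. g i x u v = 0" for u using s that by blast
qed

lemma local_metric_chart:
  assumes "semi_riemannian_manifold M g" "i \<in> charts M"
  shows "local_metric (\<lambda>y. g i (cinv M i y)) (cimg M i)"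
proof (rule local_metric.intro)
  show "open (cimg M i)"
    using assms open_cimg by (auto simp: semi_riemannian_manifold_def)
  have sm: "smooth_on (cimg M i) (\<lambda>y. g i (cinv M i y) u v)" for u v
    using assms by (simp add: semi_riemannian_manifold_def semi_riemannian_metric_def)
  fix z u v a assume z: "z \<in> cimg M i"
  show "nondegenerate_form (g i (cinv M i z))"
    using assms cinv_in_cdom[OF z] by (rule semi_riemannian_form)
  show "(\<lambda>y. g i (cinv M i y) u v) differentiable (at z)"
    using sm z by (rule smooth_on_differentiable)
  show "(\<lambda>y. metric_deriv (\<lambda>y. g i (cinv M i y)) y a u v) differentiable (at z)"
    unfolding metric_deriv_def using smooth_on_dir_deriv[OF sm] z by (rule smooth_on_differentiable)
qed

lemma riemann_in_chart:
  assumes "local_metric (\<lambda>y. g c (cinv M c y)) S" "cmap M c m \<in> S" "cinv M c (cmap M c m) = m"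
  shows "riemann M g c m u v w = g c m (curv (\<lambda>y. g c (cinv M c y)) (cmap M c m) u v w)"
  unfolding riemann_def local_metric.local_riemann_eq[OF assms(1,2)] by (simp add: assms(3))

lemma ricci_in_chart:
  assumes "local_metric (\<lambda>y. g c (cinv M c y)) S" "cmap M c m \<in> S" "cinv M c (cmap M c m) = m"
  shows "ricci M g c m u v = (\<Sum>a\<in>Basis. curv (\<lambda>y. g c (cinv M c y)) (cmap M c m) a u v \<bullet> a)"
proof -
  have "nondegenerate_form (g c m)"
    using local_metric.form[OF assms(1,2)] by (simp add: assms(3))
  then show ?thesis
    unfolding ricci_def riemann_in_chart[where g = g and c = c, OF assms] by (rule nondegenerate_form.contraction_eq_trace)
qed

text \<open>Pointwise proportionality suffices: taking traces identifies the factor as the scalar curvature divided by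
  the dimension.\<close>
lemma einsteinI:
  fixes M :: "('a, 'i, 'e::euclidean_space) manifold"
  assumes M: "semi_riemannian_manifold M g"
    and ric: "\<And>i x. i \<in> charts M \<Longrightarrow> x \<in> cdom M i \<Longrightarrow> \<exists>\<mu>. \<forall>u v. ricci M g i x u v = \<mu> * g i x u v"
  shows "einstein M g"
  unfolding einstein_def
proof (intro ballI allI)
  fix i x u v assume i: "i \<in> charts M" and x: "x \<in> cdom M i"
  interpret nondegenerate_form "g i x" by (rule semi_riemannian_form[OF M i x])
  obtain \<mu> where \<mu>: "\<And>u v. ricci M g i x u v = \<mu> * g i x u v" using ric[OF i x] by blast
  have "ricci M g i x = (\<lambda>a c. g i x (\<mu> *\<^sub>R a) c)"
    by (simp add: fun_eq_iff \<mu> bilinear_lmul[OF bil])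
  then have "scalar_curvature M g i x = (\<Sum>a\<in>(Basis :: 'e set). (\<mu> *\<^sub>R a) \<bullet> a)"
    unfolding scalar_curvature_def by (simp only: contraction_eq_trace)
  also have "\<dots> = \<mu> * real DIM('e)" by simp
  finally show "ricci M g i x u v = scalar_curvature M g i x / real DIM('e) * g i x u v"
    by (simp add: \<mu>)
qed

text \<open>Outside the product of the two images, \<^const>\<open>inv_into\<close> is unspecified and the equation may fail.\<close>
lemma cinv_product:
  assumes "smooth_manifold Mb" "i \<in> charts Mb" "smooth_manifold Mf" "j \<in> charts Mf"
    and z: "z \<in> cimg Mb i \<times> cimg Mf j"
  shows "cinv (product_manifold Mb Mf) (i, j) z = (cinv Mb i (fst z), cinv Mf j (snd z))"
proof -
  have "inj_on (map_prod (cmap Mb i) (cmap Mf j)) (cdom Mb i \<times> cdom Mf j)"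
    by (intro map_prod_inj_on inj_on_chart assms)
  moreover have "fst z \<in> cimg Mb i" "snd z \<in> cimg Mf j" using z by auto
  ultimately show ?thesis
    unfolding cinv_def[of "product_manifold Mb Mf"]
    by (intro inv_into_f_eq)
      (auto simp: product_manifold_def cinv_in_cdom cmap_cinv)
qed

lemma local_warped_product_chart:
  assumes base: "semi_riemannian_manifold Mb gb" and fiber: "semi_riemannian_manifold Mf gf"
    and f: "smooth_function Mb f" "\<And>x. x \<in> topspace (mtop Mb) \<Longrightarrow> f x > 0"
    and i: "i \<in> charts Mb" and j: "j \<in> charts Mf"
  shows "local_warped_product (\<lambda>y. gb i (cinv Mb i y)) (cimg Mb i)
    (\<lambda>y. gf j (cinv Mf j y)) (cimg Mf j) (f \<circ> cinv Mb i)
    (\<lambda>z. warped_metric f gb gf (i, j) (cinv (product_manifold Mb Mf) (i, j) z))"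
proof (intro local_warped_product.intro local_warped_product_axioms.intro)
  show "local_metric (\<lambda>y. gb i (cinv Mb i y)) (cimg Mb i)" using base i by (rule local_metric_chart)
  show "local_metric (\<lambda>y. gf j (cinv Mf j y)) (cimg Mf j)" using fiber j by (rule local_metric_chart)
  have sm: "smooth_manifold Mb" "smooth_manifold Mf"
    using base fiber by (simp_all add: semi_riemannian_manifold_def)
  have sf: "smooth_on (cimg Mb i) (f \<circ> cinv Mb i)" using f(1) i by (simp add: smooth_function_def)
  show "(f \<circ> cinv Mb i) x > 0" if "x \<in> cimg Mb i" for x
    using f(2) cinv_in_cdom[OF that] cdom_subset[OF sm(1) i] by auto
  show "(f \<circ> cinv Mb i) differentiable (at x)" if "x \<in> cimg Mb i" for x
    using sf that by (rule smooth_on_differentiable)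
  show "(\<lambda>y. dir_deriv (f \<circ> cinv Mb i) y a) differentiable (at x)" if "x \<in> cimg Mb i" for x a
    using smooth_on_dir_deriv[OF sf] that by (rule smooth_on_differentiable)
  show "warped_metric f gb gf (i, j) (cinv (product_manifold Mb Mf) (i, j) z) U V
      = gb i (cinv Mb i (fst z)) (fst U) (fst V)
        + (f \<circ> cinv Mb i) (fst z) * gf j (cinv Mf j (snd z)) (snd U) (snd V)"
    if "z \<in> cimg Mb i \<times> cimg Mf j" for z U V
    by (simp add: warped_metric_def cinv_product[OF sm(1) i sm(2) j that])
qed

theorem theorem5p6:
  fixes Mb :: "('a, 'i, 'e::euclidean_space) manifold"
    and Mf :: "('b, 'j, 'f::euclidean_space) manifold"
    and gb :: "'i \<Rightarrow> 'a \<Rightarrow> 'e \<Rightarrow> 'e \<Rightarrow> real"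
    and gf :: "'j \<Rightarrow> 'b \<Rightarrow> 'f \<Rightarrow> 'f \<Rightarrow> real"
    and f :: "'a \<Rightarrow> real"
    and L1 :: "'a \<times> 'b \<Rightarrow> real"
    and M :: "('a \<times> 'b, 'i \<times> 'j, 'e \<times> 'f) manifold"
    and g :: "'i \<times> 'j \<Rightarrow> 'a \<times> 'b \<Rightarrow> 'e \<times> 'f \<Rightarrow> 'e \<times> 'f \<Rightarrow> real"
  assumes dim: "DIM('e \<times> 'f) \<ge> 3"
    and base: "semi_riemannian_manifold Mb gb"
    and fiber: "semi_riemannian_manifold Mf gf"
    and f_smooth: "smooth_function Mb f"
    and f_pos: "\<And>x. x \<in> topspace (mtop Mb) \<Longrightarrow> f x > 0"
    and M_def: "M = product_manifold Mb Mf"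
    and g_def: "g = warped_metric f gb gf"
    and conn: "connected_space (mtop M)"
    and L1_smooth: "smooth_function M L1"
    and pseudosymmetric:
      "\<And>c m xs X Y. c \<in> charts M \<Longrightarrow> m \<in> cdom M c \<Longrightarrow> length xs = 4 \<Longrightarrow>
         derivation_action (g c m) (projective M g c m) (of_tensor4 (riemann M g c m)) xs X Y
         = L1 m * tachibana (g c m) (of_tensor4 (riemann M g c m)) xs X Y"
  shows "flat Mb gb \<or> einstein Mf gf"
proof (rule disjCI)
  assume "\<not> einstein Mf gf"
  show "flat Mb gb"
    unfolding flat_def
  proof (intro ballI allI, rule ccontr)
    \<comment> \<open>A single nonzero component of the base curvature, at a single point \<open>x\<close>, forces the fiber to be Einstein at
    every point \<open>y\<close>, by evaluation at \<open>(x, y)\<close>.\<close>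
    fix i x a b c d
    assume i: "i \<in> charts Mb" and x: "x \<in> cdom Mb i"
      and nz: "riemann Mb gb i x a b c d \<noteq> 0"
    have sm: "smooth_manifold Mb" "smooth_manifold Mf"
      using base fiber by (simp_all add: semi_riemannian_manifold_def)
    have "einstein Mf gf"
    proof (rule einsteinI[OF fiber])
      fix j y assume j: "j \<in> charts Mf" and y: "y \<in> cdom Mf j"
      let ?z = "(cmap Mb i x, cmap Mf j y)" and ?m = "(x, y)" and ?c = "(i, j)"
      have z: "?z \<in> cimg Mb i \<times> cimg Mf j" using x y by (simp add: cmap_in_cimg)
      interpret W: local_warped_product "\<lambda>y. gb i (cinv Mb i y)" "cimg Mb i"
        "\<lambda>y. gf j (cinv Mf j y)" "cimg Mf j" "f \<circ> cinv Mb i" "\<lambda>z. g ?c (cinv M ?c z)"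
        unfolding M_def g_def
        using base fiber f_smooth f_pos i j by (rule local_warped_product_chart)
      have inv: "cinv Mb i (cmap Mb i x) = x" "cinv Mf j (cmap Mf j y) = y"
        by (rule cinv_cmap[OF sm(1) i x], rule cinv_cmap[OF sm(2) j y])
      have cz: "cmap M ?c ?m = ?z" by (simp add: M_def product_manifold_def)
      have inv_z: "cinv M ?c ?z = ?m"
        by (simp add: M_def cinv_product[OF sm(1) i sm(2) j z] inv)
      note chart_facts = W.total.local_metric_axioms z[folded cz] inv_z[folded cz]
      let ?R = "\<lambda>U V Z. g ?c ?m (curv (\<lambda>z. g ?c (cinv M ?c z)) ?z U V Z)"
      have R: "riemann M g ?c ?m = ?R"
        using riemann_in_chart[where g = g, OF chart_facts] by (simp add: fun_eq_iff cz)
      define k where "k = 1 / (real DIM('e \<times> 'f) - 2)"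
      have "k \<noteq> 0" using dim by (simp add: k_def)
      have P: "projective M g ?c ?m = (\<lambda>U V Z X. ?R U V Z X
          - k * (ricci M g ?c ?m V Z * g ?c ?m U X - ricci M g ?c ?m U Z * g ?c ?m V X))"
        by (simp add: projective_def R k_def fun_eq_iff)
      have cm: "?c \<in> charts M" "?m \<in> cdom M ?c"
        using i j x y by (simp_all add: M_def product_manifold_def)
      obtain C where C: "\<And>\<alpha> \<beta>. k * ricci M g ?c ?m (0, \<beta>) (0, \<alpha>)
          * gb i x (curv (\<lambda>y. gb i (cinv Mb i y)) (cmap Mb i x) a b c) d = C * gf j y \<beta> \<alpha>"
      proof (rule W.fiber_block_proportional[OF z, of k "ricci M g ?c ?m" a b c d "L1 ?m", unfolded inv_z fst_conv snd_conv inv])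
        show "derivation_action (g ?c ?m)
            (\<lambda>U V Z X. ?R U V Z X - k * (ricci M g ?c ?m V Z * g ?c ?m U X - ricci M g ?c ?m U Z * g ?c ?m V X))
            (of_tensor4 ?R) [(a, 0), (b, 0), (c, 0), (0, \<alpha>)] (d, 0) (0, \<beta>)
          = L1 ?m * tachibana (g ?c ?m) (of_tensor4 ?R) [(a, 0), (b, 0), (c, 0), (0, \<alpha>)] (d, 0) (0, \<beta>)"
          for \<alpha> \<beta>
          by (rule pseudosymmetric[OF cm, unfolded P R]) simp
      qed (rule that)
      obtain C' where C': "\<And>\<beta> \<gamma>. ricci M g ?c ?m (0, \<beta>) (0, \<gamma>)
          = ricci Mf gf j y \<beta> \<gamma> + C' * gf j y \<beta> \<gamma>"
      proof (rule W.ricci_fiber[OF z, unfolded snd_conv inv])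
        fix C
        assume "\<And>\<beta> \<gamma>. (\<Sum>A\<in>Basis. curv (\<lambda>z. g ?c (cinv M ?c z)) ?z A (0, \<beta>) (0, \<gamma>) \<bullet> A)
          = (\<Sum>\<alpha>\<in>Basis. curv (\<lambda>y. gf j (cinv Mf j y)) (cmap Mf j y) \<alpha> \<beta> \<gamma> \<bullet> \<alpha>)
            + C * gf j y \<beta> \<gamma>"
        then show thesis
          by (intro that[of C])
            (simp add: ricci_in_chart[where g = g, OF chart_facts] cz
              ricci_in_chart[where g = gf, OF W.fiber.local_metric_axioms cmap_in_cimg[OF y] inv(2)])
      qed
      have r: "riemann Mb gb i x a b c d
          = gb i x (curv (\<lambda>y. gb i (cinv Mb i y)) (cmap Mb i x) a b c) d"
        using riemann_in_chart[where g = gb, OF W.base.local_metric_axioms cmap_in_cimg[OF x] inv(1)] by simp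
      have "ricci Mf gf j y u v = (C / (k * riemann Mb gb i x a b c d) - C') * gf j y u v" for u v
        using C[of u v] C'[of u v] nz \<open>k \<noteq> 0\<close> by (simp add: r[symmetric] field_simps)
      then show "\<exists>\<mu>. \<forall>u v. ricci Mf gf j y u v = \<mu> * gf j y u v" by blast
    qed
    with \<open>\<not> einstein Mf gf\<close> show False ..
  qed
qed

end
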